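(* Let $i\in\mathbb Z$, $x,x'\in\mathcal L_i$, $a\in\mathbb A_i$ and let $Z$ be an internal predicate. Then every point $p$ with $p\models x\doteq x'$ satisfies $p\models Z[a\mapsto x]\leftrightarrow Z[a\mapsto x']$; that is, $[\![x\doteq x']\!]\subseteq[\![Z[a\mapsto x]\leftrightarrow Z[a\mapsto x']]\!]$.
   Context: Atoms: for each $i\in\mathbb Z$ a set $\mathbb A_i$ of atoms (pairwise disjoint, each of cardinality $\beth_\omega$). Small = cardinality $<\beth_\omega$; generous = cardinality $\beth_\omega$; $\mathsf N a'\in\mathbb A_i.\Phi(a')$ means $\{a'\in\mathbb A_i:\Phi(a')\}$ has small complement in $\mathbb A_i$. $(a\,b)$ swaps atoms of equal level. Internal syntax (binders $[a]$ up to $\alpha$-equivalence): internal predicates $\wedge(\mathcal X)$ ($\mathcal X$ finite), $\neg X$, $\forall[a]X$, $\in(x,a)$ with $a\in\mathbb A_{i+1}$, $x\in\mathcal L_i$; internal sets of level $i$ ($\mathcal L_i$): $\mathrm{atm}(a)$ ($a\in\mathbb A_i$), $[a]X$ ($a\in\mathbb A_{i-1}$). $a\#Z$: $a$ not free in $Z$; $x@b=(b\,a)\cdot X$ for $x=[a]X$, $b$ fresh. Sugar: $X\vee Y=\neg\wedge\{\neg X,\neg Y\}$, $X\to Y=(\neg X)\vee Y$, $X\leftrightarrow Y=\wedge\{X\to Y,Y\to X\}$. Substitution $Z[a\mapsto x]$ ($a\in\mathbb A_i$, $x\in\mathcal L_i$): $\wedge(\mathcal X)[a\mapsto x]=\wedge\{X[a\mapsto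 x]\}$; $(\neg X)[a\mapsto x]=\neg(X[a\mapsto x])$; $(\forall[b]X)[a\mapsto x]=\forall[b](X[a\mapsto x])$ for $b\#x$; $\in(y,a)[a\mapsto\mathrm{atm}(n)]=\in(y[a\mapsto\mathrm{atm}(n)],n)$; $\in(y,a)[a\mapsto[a']X]=X[a'\mapsto y[a\mapsto[a']X]]$ ($a'$ fresh); $\in(y,b)[a\mapsto x]=\in(y[a\mapsto x],b)$ for $b\ne a$; $\mathrm{atm}(a)[a\mapsto x]=x$; $\mathrm{atm}(b)[a\mapsto x]=\mathrm{atm}(b)$; $([c]X)[a\mapsto x]=[c](X[a\mapsto x])$ for $c\#x$ (well defined). For $x\in\mathcal L_i$, $y\in\mathcal L_{i-1}$: $y\mathrel{\dot\in}x=(x@b)[b\mapsto y]$ ($b$ fresh) if $x$ is a comprehension, $y\mathrel{\dot\in}\mathrm{atm}(a)=\in(y,a)$; for an atom $c$ write $c\mathrel{\dot\in}x$ for $\mathrm{atm}(c)\mathrel{\dot\in}x$. For $x,x'\in\mathcal L_i$: $x\doteq x'=\forall[c]((c\mathrel{\dot\in}x)\leftrightarrow(c\mathrel{\dot\in}x'))$ with $c\in\mathbb A_{i-1}$ fresh. Prepoints: subsets $p$ of $\bigcup_i\mathbb A_i\times\mathcal L_{i-1}$ (elements $a\triangleright y$). Validity: $p\models\wedge(\mathcal X)$ iff all $p\models X$; $p\models\neg X$ iff not $p\models X$; $p\models\forall[a]X$ iff $\mathsf N a'\in\mathbb A_{\mathrm{level}(a)}.\,p\models(a'\,a)\cdot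 X$; $p\models\in(y,a)$ iff $a\triangleright y\in p$. $p(x)=\{y:p\models y\mathrel{\dot\in}x\}$; $p\models_{ext}u=u'$ iff $p(u)=p(u')$; $p\models_{int}u=u'$ ($u,u'\in\mathcal L_i$) iff for all $j$, $b\in\mathbb A_{j+1}$, $c\in\mathbb A_i$, $y\in\mathcal L_j$: $b\triangleright y[c\mapsto u]\in p\iff b\triangleright y[c\mapsto u']\in p$. Points: $p$ generously names $x\in\mathcal L_i$ if for all $a\in\mathbb A_i$ and internal predicates $X$ the set $\{a'\in\mathbb A_i:p\models(a'\,a)\cdot X\iff p\models X[a\mapsto x]\}$ is generous. $p$ is extensional if $p\models_{ext}x=x'$ implies $p\models_{int}x=x'$ for all $x,x'$ of equal level. A shift permutation is a bijection $\vartheta$ of atoms with $\vartheta(\mathbb A_i)=\mathbb A_{i+1}$, acting on prepoints by renaming; $p$ is ambiguous if $\vartheta\cdot p=p$ for some shift permutation $\vartheta$. A point is an extensional, ambiguous prepoint that generously names every internal set. $[\![Y]\!]$ is the set of points $p$ with $p\models Y$. *)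

theory Defs
  imports "HOL-Library.FSet" "HOL-Library.Equipollence" "HOL-Combinatorics.Transposition"
begin

section \<open>Atoms\<close>

text \<open>
  A set has cardinality \<open>\<beth>\<^sub>\<omega> = sup {\<beth>\<^sub>0, \<beth>\<^sub>1, \<dots>}\<close> iff it is a union of sets \<open>B n\<close>
  with \<open>B n\<close> of cardinality \<open>\<beth>\<^sub>n\<close>, where \<open>\<beth>\<^sub>0\<close> is the cardinality of the naturals and
  \<open>\<beth>\<^sub>n\<^sub>+\<^sub>1\<close> is two to the power \<open>\<beth>\<^sub>n\<close>.
\<close>
definition card_beth_omega :: "'a set \<Rightarrow> bool" where
  "card_beth_omega A \<longleftrightarrow> (\<exists>B :: nat \<Rightarrow> 'a set.
     B 0 \<approx> (UNIV :: nat set) \<and> (\<forall>n. B (Suc n) \<approx> Pow (B n)) \<and> A = (\<Union>n. B n))"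

text \<open>The type \<open>'a\<close> is the disjoint union of the sets of atoms of the various levels.\<close>
class atom =
  fixes level :: "'a \<Rightarrow> int"
  assumes card_level: "card_beth_omega {a. level a = i}"

definition atoms :: "int \<Rightarrow> 'a::atom set" where
  "atoms i = {a. level a = i}"

definition small :: "'a set \<Rightarrow> bool" where
  "small S \<longleftrightarrow> (\<exists>T :: 'a set. card_beth_omega T \<and> S \<prec> T)"

definition generous :: "'a set \<Rightarrow> bool" where
  "generous S \<longleftrightarrow> card_beth_omega S"

definition New :: "int \<Rightarrow> ('a::atom \<Rightarrow> bool) \<Rightarrow> bool" where
  "New i \<Phi> \<longleftrightarrow> small (atoms i - {a' \<in> atoms i. \<Phi> a'})"


section \<open>Internal syntax\<close>

text \<open>
  Raw terms come first; the internal syntax is their quotient by \<open>\<alpha>\<close>-equivalence, cut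
  down to the terms that respect levels (\<open>internal_pred\<close>, \<open>internal_set\<close> below). The action
  of a renaming of atoms on raw terms, bound occurrences included, is the map function of
  the datatype.
\<close>
datatype 'a raw_pred =
    RConj "'a raw_pred fset"
  | RNeg "'a raw_pred"
  | RAll 'a "'a raw_pred"
  | RElt "'a raw_set" 'a
and 'a raw_set =
    RAtm 'a
  | RCompr 'a "'a raw_pred"

primrec rfree_p :: "'a raw_pred \<Rightarrow> 'a set" and rfree_s :: "'a raw_set \<Rightarrow> 'a set" where
  "rfree_p (RConj Xs) = \<Union> (fset (rfree_p |`| Xs))"
| "rfree_p (RNeg X) = rfree_p X"
| "rfree_p (RAll a X) = rfree_p X - {a}"
| "rfree_p (RElt x a) = insert a (rfree_s x)"
| "rfree_s (RAtm a) = {a}"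
| "rfree_s (RCompr a X) = rfree_p X - {a}"

text \<open>The least congruence that contains all capture-avoiding renamings of a bound atom.\<close>
inductive alpha_p :: "'a::atom raw_pred \<Rightarrow> 'a raw_pred \<Rightarrow> bool"
  and alpha_s :: "'a raw_set \<Rightarrow> 'a raw_set \<Rightarrow> bool" where
  refl_p: "alpha_p X X"
| sym_p: "alpha_p X Y \<Longrightarrow> alpha_p Y X"
| trans_p: "alpha_p X Y \<Longrightarrow> alpha_p Y Z \<Longrightarrow> alpha_p X Z"
| refl_s: "alpha_s x x"
| sym_s: "alpha_s x y \<Longrightarrow> alpha_s y x"
| trans_s: "alpha_s x y \<Longrightarrow> alpha_s y z \<Longrightarrow> alpha_s x z"
| cong_Conj: "rel_fset alpha_p Xs Ys \<Longrightarrow> alpha_p (RConj Xs) (RConj Ys)"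
| cong_Neg: "alpha_p X Y \<Longrightarrow> alpha_p (RNeg X) (RNeg Y)"
| cong_All: "alpha_p X Y \<Longrightarrow> alpha_p (RAll a X) (RAll a Y)"
| cong_Elt: "alpha_s x y \<Longrightarrow> alpha_p (RElt x a) (RElt y a)"
| cong_Compr: "alpha_p X Y \<Longrightarrow> alpha_s (RCompr a X) (RCompr a Y)"
| rename_All: "level b = level a \<Longrightarrow> b \<notin> rfree_p X
    \<Longrightarrow> alpha_p (RAll a X) (RAll b (map_raw_pred (transpose b a) X))"
| rename_Compr: "level b = level a \<Longrightarrow> b \<notin> rfree_p X
    \<Longrightarrow> alpha_s (RCompr a X) (RCompr b (map_raw_pred (transpose b a) X))"

quotient_type (overloaded) 'a ipred = "'a::atom raw_pred" / alpha_p
  by (rule equivpI) (auto intro!: reflpI sympI transpI intro: alpha_p_alpha_s.intros)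

quotient_type (overloaded) 'a iset = "'a::atom raw_set" / alpha_s
  by (rule equivpI) (auto intro!: reflpI sympI transpI intro: alpha_p_alpha_s.intros)

lift_definition Conj :: "'a::atom ipred fset \<Rightarrow> 'a ipred" is RConj
  by (rule cong_Conj)
lift_definition Neg :: "'a::atom ipred \<Rightarrow> 'a ipred" is RNeg
  by (rule cong_Neg)
lift_definition Forall :: "'a::atom \<Rightarrow> 'a ipred \<Rightarrow> 'a ipred" is RAll
  by (rule cong_All)
lift_definition Elt :: "'a::atom iset \<Rightarrow> 'a \<Rightarrow> 'a ipred" is RElt
  by (rule cong_Elt)
lift_definition Atm :: "'a::atom \<Rightarrow> 'a iset" is RAtm .
lift_definition Compr :: "'a::atom \<Rightarrow> 'a ipred \<Rightarrow> 'a iset" is RCompr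
  by (rule cong_Compr)


text \<open>
  Renaming of atoms on the quotients. For a bijection \<open>\<pi>\<close> that maps atoms to the same level
  iff they are of the same level, such as a swapping of atoms of equal level or a shift
  permutation, the result does not depend on the representative (\<open>ren_p_abs\<close>, \<open>ren_s_abs\<close> below).
\<close>
definition ren_p :: "('a \<Rightarrow> 'a) \<Rightarrow> 'a::atom ipred \<Rightarrow> 'a ipred" where
  "ren_p \<pi> X = abs_ipred (map_raw_pred \<pi> (rep_ipred X))"

definition ren_s :: "('a \<Rightarrow> 'a) \<Rightarrow> 'a::atom iset \<Rightarrow> 'a iset" where
  "ren_s \<pi> x = abs_iset (map_raw_set \<pi> (rep_iset x))"

definition free_p :: "'a::atom ipred \<Rightarrow> 'a set" where
  "free_p X = rfree_p (rep_ipred X)"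

definition free_s :: "'a::atom iset \<Rightarrow> 'a set" where
  "free_s x = rfree_s (rep_iset x)"

inductive internal_pred :: "'a::atom ipred \<Rightarrow> bool"
  and internal_set :: "int \<Rightarrow> 'a iset \<Rightarrow> bool" where
  "(\<forall>X. X |\<in>| Xs \<longrightarrow> internal_pred X) \<Longrightarrow> internal_pred (Conj Xs)"
| "internal_pred X \<Longrightarrow> internal_pred (Neg X)"
| "internal_pred X \<Longrightarrow> internal_pred (Forall a X)"
| "internal_set i x \<Longrightarrow> a \<in> atoms (i + 1) \<Longrightarrow> internal_pred (Elt x a)"
| "a \<in> atoms i \<Longrightarrow> internal_set i (Atm a)"
| "a \<in> atoms (i - 1) \<Longrightarrow> internal_pred X \<Longrightarrow> internal_set i (Compr a X)"

definition isets :: "int \<Rightarrow> 'a::atom iset set" ("\<L>") where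
  "\<L> i = {x. internal_set i x}"

definition Disj :: "'a::atom ipred \<Rightarrow> 'a ipred \<Rightarrow> 'a ipred" where
  "Disj X Y = Neg (Conj {|Neg X, Neg Y|})"

definition Imp :: "'a::atom ipred \<Rightarrow> 'a ipred \<Rightarrow> 'a ipred" where
  "Imp X Y = Disj (Neg X) Y"

definition Iff :: "'a::atom ipred \<Rightarrow> 'a ipred \<Rightarrow> 'a ipred" where
  "Iff X Y = Conj {|Imp X Y, Imp Y X|}"


section \<open>Substitution\<close>

text \<open>
  The defining clauses as a relation: \<open>subst_p_rel Z a x W\<close> says that they yield \<open>W\<close> for
  \<open>Z[a \<mapsto> x]\<close>. On internal predicates and sets the relation is functional and total
  (\<open>subst_rel_unique\<close>, \<open>subst_p_rel_subst\<close>, \<open>subst_s_rel_subst\<close> below). As usual, choosing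
  a bound atom fresh includes choosing it distinct from the atom \<open>a\<close> that is substituted for.
\<close>
inductive subst_p_rel :: "'a::atom ipred \<Rightarrow> 'a \<Rightarrow> 'a iset \<Rightarrow> 'a ipred \<Rightarrow> bool"
  and subst_s_rel :: "'a iset \<Rightarrow> 'a \<Rightarrow> 'a iset \<Rightarrow> 'a iset \<Rightarrow> bool" where
  sub_Conj: "(\<forall>X. X |\<in>| Xs \<longrightarrow> subst_p_rel X a x (f X))
    \<Longrightarrow> subst_p_rel (Conj Xs) a x (Conj (f |`| Xs))"
| sub_Neg: "subst_p_rel X a x X' \<Longrightarrow> subst_p_rel (Neg X) a x (Neg X')"
| sub_All: "b \<noteq> a \<Longrightarrow> b \<notin> free_s x \<Longrightarrow> subst_p_rel X a x X'
    \<Longrightarrow> subst_p_rel (Forall b X) a x (Forall b X')"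
| sub_Elt_Atm: "subst_s_rel y a (Atm n) y' \<Longrightarrow> subst_p_rel (Elt y a) a (Atm n) (Elt y' n)"
| sub_Elt_Compr: "a' \<noteq> a \<Longrightarrow> a' \<notin> free_s y \<Longrightarrow> subst_s_rel y a (Compr a' X) y'
    \<Longrightarrow> subst_p_rel X a' y' W \<Longrightarrow> subst_p_rel (Elt y a) a (Compr a' X) W"
| sub_Elt_other: "b \<noteq> a \<Longrightarrow> subst_s_rel y a x y' \<Longrightarrow> subst_p_rel (Elt y b) a x (Elt y' b)"
| sub_Atm: "subst_s_rel (Atm a) a x x"
| sub_Atm_other: "b \<noteq> a \<Longrightarrow> subst_s_rel (Atm b) a x (Atm b)"
| sub_Compr: "c \<noteq> a \<Longrightarrow> c \<notin> free_s x \<Longrightarrow> subst_p_rel X a x X'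
    \<Longrightarrow> subst_s_rel (Compr c X) a x (Compr c X')"

definition subst_p :: "'a::atom ipred \<Rightarrow> 'a \<Rightarrow> 'a iset \<Rightarrow> 'a ipred" ("_[_ \<mapsto>\<^sub>p _]" [1000, 0, 0] 1000) where
  "Z[a \<mapsto>\<^sub>p x] = (THE W. subst_p_rel Z a x W)"

definition subst_s :: "'a::atom iset \<Rightarrow> 'a \<Rightarrow> 'a iset \<Rightarrow> 'a iset" ("_[_ \<mapsto>\<^sub>s _]" [1000, 0, 0] 1000) where
  "y[a \<mapsto>\<^sub>s x] = (THE z. subst_s_rel y a x z)"

text \<open>\<open>concrete x b\<close> is \<open>x@b\<close>, for a comprehension \<open>x\<close> and \<open>b\<close> not free in \<open>x\<close>.\<close>
definition concrete :: "'a::atom iset \<Rightarrow> 'a \<Rightarrow> 'a ipred" where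
  "concrete x b = (THE W. \<exists>a X. x = Compr a X \<and> level b = level a \<and> W = ren_p (transpose b a) X)"

definition is_Atm :: "'a::atom iset \<Rightarrow> bool" where
  "is_Atm x \<longleftrightarrow> (\<exists>a. x = Atm a)"

definition fresh_atom :: "int \<Rightarrow> 'a::atom set \<Rightarrow> 'a" where
  "fresh_atom i A = (SOME b. b \<in> atoms i \<and> b \<notin> A)"

text \<open>The membership predicate for \<open>x\<close> of level \<open>i\<close> and \<open>y\<close> of level \<open>i - 1\<close>.\<close>
definition mem :: "int \<Rightarrow> 'a::atom iset \<Rightarrow> 'a iset \<Rightarrow> 'a ipred" where
  "mem i y x =
     (if is_Atm x then Elt y (THE a. x = Atm a)
      else let b = fresh_atom (i - 1) (free_s x \<union> free_s y) in (concrete x b)[b \<mapsto>\<^sub>p y])"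

text \<open>The equality predicate for \<open>x\<close> and \<open>x'\<close> of level \<open>i\<close>.\<close>
definition Eq :: "int \<Rightarrow> 'a::atom iset \<Rightarrow> 'a iset \<Rightarrow> 'a ipred" where
  "Eq i x x' =
     (let c = fresh_atom (i - 1) (free_s x \<union> free_s x')
      in Forall c (Iff (mem i (Atm c) x) (mem i (Atm c) x')))"


section \<open>Prepoints and validity\<close>

text \<open>A pair \<open>(a, y)\<close> of a prepoint is the element written \<open>a \<triangleright> y\<close>.\<close>
definition prepoint :: "('a::atom \<times> 'a iset) set \<Rightarrow> bool" where
  "prepoint p \<longleftrightarrow> p \<subseteq> (\<Union>i. atoms i \<times> \<L> (i - 1))"

lemma size_RConj: "X |\<in>| Xs \<Longrightarrow> size X < size (RConj Xs)"
proof -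
  assume "X |\<in>| Xs"
  then have "Suc (size X) \<le> (\<Sum>x\<in>fset Xs. Suc (size x))"
    by (intro member_le_sum) auto
  then show ?thesis by (simp add: size_fset_simps)
qed

lemma size_map_raw: "inj f \<Longrightarrow> size (map_raw_pred f X) = size X" 
  using raw_pred.size_gen_o_map[of f "\<lambda>_. 0"] 
  by (simp add: fun_eq_iff o_def size_raw_pred_overloaded_def)

text \<open>
  Validity is defined by recursion on a representative. It does not depend on the choice;
  \<open>valid_simps\<close> below gives the clauses on the quotient.
\<close>
function (sequential) rvalid :: "('a::atom \<times> 'a iset) set \<Rightarrow> 'a raw_pred \<Rightarrow> bool" where
  "rvalid p (RConj Xs) \<longleftrightarrow> (\<forall>X \<in> fset Xs. rvalid p X)"
| "rvalid p (RNeg X) \<longleftrightarrow> \<not> rvalid p X"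
| "rvalid p (RAll a X) \<longleftrightarrow> New (level a) (\<lambda>a'. rvalid p (map_raw_pred (transpose a' a) X))"
| "rvalid p (RElt y a) \<longleftrightarrow> (a, abs_iset y) \<in> p"
  by pat_completeness auto

termination
  by (relation "measure (\<lambda>(p, X). size X)")
    (auto simp: size_RConj size_map_raw less_Suc_eq_le bij_is_inj simp del: raw_pred.size(5))

definition valid :: "('a::atom \<times> 'a iset) set \<Rightarrow> 'a ipred \<Rightarrow> bool" (infix "\<Turnstile>" 50) where
  "p \<Turnstile> X \<longleftrightarrow> rvalid p (rep_ipred X)"

text \<open>The extension \<open>p(x)\<close> of \<open>x\<close> of level \<open>i\<close>.\<close>
definition extension :: "('a::atom \<times> 'a iset) set \<Rightarrow> int \<Rightarrow> 'a iset \<Rightarrow> 'a iset set" where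
  "extension p i x = {y \<in> \<L> (i - 1). p \<Turnstile> mem i y x}"

definition ext_eq :: "('a::atom \<times> 'a iset) set \<Rightarrow> int \<Rightarrow> 'a iset \<Rightarrow> 'a iset \<Rightarrow> bool" where
  "ext_eq p i u u' \<longleftrightarrow> extension p i u = extension p i u'"

definition int_eq :: "('a::atom \<times> 'a iset) set \<Rightarrow> int \<Rightarrow> 'a iset \<Rightarrow> 'a iset \<Rightarrow> bool" where
  "int_eq p i u u' \<longleftrightarrow> (\<forall>j. \<forall>b \<in> atoms (j + 1). \<forall>c \<in> atoms i. \<forall>y \<in> \<L> j.
     (b, y[c \<mapsto>\<^sub>s u]) \<in> p \<longleftrightarrow> (b, y[c \<mapsto>\<^sub>s u']) \<in> p)"


section \<open>Points\<close>

definition generously_names :: "('a::atom \<times> 'a iset) set \<Rightarrow> int \<Rightarrow> 'a iset \<Rightarrow> bool" where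
  "generously_names p i x \<longleftrightarrow> (\<forall>a \<in> atoms i. \<forall>X. internal_pred X \<longrightarrow>
     generous {a' \<in> atoms i. p \<Turnstile> ren_p (transpose a' a) X \<longleftrightarrow> p \<Turnstile> X[a \<mapsto>\<^sub>p x]})"

definition extensional :: "('a::atom \<times> 'a iset) set \<Rightarrow> bool" where
  "extensional p \<longleftrightarrow> (\<forall>i. \<forall>x \<in> \<L> i. \<forall>x' \<in> \<L> i. ext_eq p i x x' \<longrightarrow> int_eq p i x x')"

definition shift_perm :: "('a::atom \<Rightarrow> 'a) \<Rightarrow> bool" where
  "shift_perm \<theta> \<longleftrightarrow> bij \<theta> \<and> (\<forall>i. \<theta> ` atoms i = atoms (i + 1))"

definition ambiguous :: "('a::atom \<times> 'a iset) set \<Rightarrow> bool" where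
  "ambiguous p \<longleftrightarrow> (\<exists>\<theta>. shift_perm \<theta> \<and> map_prod \<theta> (ren_s \<theta>) ` p = p)"

definition point :: "('a::atom \<times> 'a iset) set \<Rightarrow> bool" where
  "point p \<longleftrightarrow> prepoint p \<and> extensional p \<and> ambiguous p \<and>
     (\<forall>i. \<forall>x \<in> \<L> i. generously_names p i x)"

definition extent :: "'a::atom ipred \<Rightarrow> ('a \<times> 'a iset) set set" where
  "extent Y = {p. point p \<and> p \<Turnstile> Y}"


section \<open>Well-definedness\<close>

text \<open>The definitions above that pick representatives, fresh atoms or results are independent of the choices.\<close>

lemma rfree_map:
  assumes "inj f"
  shows "rfree_p (map_raw_pred f X) = f ` rfree_p X" "rfree_s (map_raw_set f x) = f ` rfree_s x"
   apply (induct X and x)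
  using assms
  by (auto simp: image_set_diff inj_image_mem_iff)

lemma finite_rfree:
 fixes X :: "'a raw_pred" and x :: "'a raw_set" shows "finite (rfree_p X)" and "finite (rfree_s x)"
  by (induct X and x) auto

lemma rfree_alpha:
 fixes X Y :: "'a::atom raw_pred" and x y :: "'a raw_set"
  shows "alpha_p X Y \<Longrightarrow> rfree_p X = rfree_p Y" and "alpha_s x y \<Longrightarrow> rfree_s x = rfree_s y"
proof (induct rule: alpha_p_alpha_s.inducts)
  case (cong_Conj Xs Ys)
  then show ?case by (force simp: rel_fset_alt_def)
next
  case (rename_All b a X)
  then show ?case by (auto simp: rfree_map transpose_def split: if_splits)
next
  case (rename_Compr b a X)
  then show ?case by (auto simp: rfree_map transpose_def split: if_splits)
qed auto

definition renaming :: "('a::atom \<Rightarrow> 'a) \<Rightarrow> bool" where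
  "renaming \<pi> \<longleftrightarrow> bij \<pi> \<and> (\<forall>a b. level (\<pi> a) = level (\<pi> b) \<longleftrightarrow> level a = level b)"

lemma good_inj: "renaming \<pi> \<Longrightarrow> inj \<pi>"
  by (simp add: renaming_def bij_is_inj)

lemma good_transpose: "level a = level b \<Longrightarrow> renaming (transpose a b)"
  unfolding renaming_def using transpose_apply_other[of _ a b]
  by (metis bij_transpose transpose_apply_first transpose_apply_second)

lemma good_comp: "renaming \<pi> \<Longrightarrow> renaming \<sigma> \<Longrightarrow> renaming (\<pi> \<circ> \<sigma>)"
  by (simp add: renaming_def bij_comp)

lemma good_id: "renaming id" "renaming (\<lambda>x. x)"
  using bij_id[unfolded id_def] by (simp_all add: renaming_def)

lemma inj_comp_transpose: "inj \<pi> \<Longrightarrow> \<pi> \<circ> transpose b a = transpose (\<pi> b) (\<pi> a) \<circ> \<pi>"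
  by (auto simp: fun_eq_iff transpose_def inj_eq)

lemma alpha_map:
  fixes X Y :: "'a::atom raw_pred" and x y :: "'a raw_set"
  shows "alpha_p X Y \<Longrightarrow> renaming \<pi> \<Longrightarrow> alpha_p (map_raw_pred \<pi> X) (map_raw_pred \<pi> Y)"
    and "alpha_s x y \<Longrightarrow> renaming \<pi> \<Longrightarrow> alpha_s (map_raw_set \<pi> x) (map_raw_set \<pi> y)"
proof (induct rule: alpha_p_alpha_s.inducts)
  case (cong_Conj Xs Ys)
  then show ?case
    by (auto intro!: alpha_p_alpha_s.cong_Conj simp: rel_fset_alt_def) (meson)+
next
  case (rename_All b a X)
  have *: "map_raw_pred \<pi> (map_raw_pred (transpose b a) X) = map_raw_pred (transpose (\<pi> b) (\<pi> a)) (map_raw_pred \<pi> X)"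
    using inj_comp_transpose[OF good_inj[OF rename_All(3)]] by (simp add: raw_pred.map_comp)
  have "\<pi> b \<notin> rfree_p (map_raw_pred \<pi> X)"
    using rename_All by (simp add: rfree_map good_inj inj_image_mem_iff)
  then show ?case using rename_All
    by (simp add: * renaming_def alpha_p_alpha_s.rename_All)
next
  case (rename_Compr b a X)
  have *: "map_raw_pred \<pi> (map_raw_pred (transpose b a) X) = map_raw_pred (transpose (\<pi> b) (\<pi> a)) (map_raw_pred \<pi> X)"
    using inj_comp_transpose[OF good_inj[OF rename_Compr(3)]] by (simp add: raw_pred.map_comp)
  have "\<pi> b \<notin> rfree_p (map_raw_pred \<pi> X)"
    using rename_Compr by (simp add: rfree_map good_inj inj_image_mem_iff)
  then show ?case using rename_Compr
    by (simp add: * renaming_def alpha_p_alpha_s.rename_Compr)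
qed (auto intro: alpha_p_alpha_s.intros)

lemma rel_fset_map_self: "(\<And>X. X |\<in>| Xs \<Longrightarrow> R (f X) X) \<Longrightarrow> rel_fset R (f |`| Xs) Xs"
  by (auto simp: rel_fset_alt_def)

lemma alpha_fresh:
  fixes X :: "'a::atom raw_pred" and x :: "'a raw_set"
  assumes "level b = level c"
  shows "b \<notin> rfree_p X \<Longrightarrow> c \<notin> rfree_p X \<Longrightarrow> alpha_p (map_raw_pred (transpose b c) X) X"
    and "b \<notin> rfree_s x \<Longrightarrow> c \<notin> rfree_s x \<Longrightarrow> alpha_s (map_raw_set (transpose b c) x) x"
proof (induct X and x)
  case (RConj Xs)
  then show ?case
    by (auto intro!: alpha_p_alpha_s.cong_Conj rel_fset_map_self)
next
  case (RAll d X)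
  consider "b = c" | "b \<noteq> c" "d = b" | "b \<noteq> c" "d = c" | "d \<noteq> b" "d \<noteq> c" by blast
  then show ?case
  proof cases
    case 1
    then show ?thesis by (simp add: transpose_same raw_pred.map_id0 alpha_p_alpha_s.refl_p id_def[symmetric])
  next
    case 2
    then have "alpha_p (RAll b X) (RAll c (map_raw_pred (transpose c b) X))"
      using RAll assms by (intro alpha_p_alpha_s.rename_All) auto
    then show ?thesis using 2 by (simp add: transpose_commute alpha_p_alpha_s.sym_p)
  next
    case 3
    then have "alpha_p (RAll c X) (RAll b (map_raw_pred (transpose b c) X))"
      using RAll assms by (intro alpha_p_alpha_s.rename_All) auto
    then show ?thesis using 3 by (simp add: alpha_p_alpha_s.sym_p)
  next
    case 4
    then show ?thesis using RAll by (simp add: alpha_p_alpha_s.cong_All)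
  qed
next
  case (RCompr d X)
  consider "b = c" | "b \<noteq> c" "d = b" | "b \<noteq> c" "d = c" | "d \<noteq> b" "d \<noteq> c" by blast
  then show ?case
  proof cases
    case 1
    then show ?thesis by (simp add: transpose_same raw_pred.map_id0 alpha_p_alpha_s.refl_s id_def[symmetric])
  next
    case 2
    then have "alpha_s (RCompr b X) (RCompr c (map_raw_pred (transpose c b) X))"
      using RCompr assms by (intro alpha_p_alpha_s.rename_Compr) auto
    then show ?thesis using 2 by (simp add: transpose_commute alpha_p_alpha_s.sym_s)
  next
    case 3
    then have "alpha_s (RCompr c X) (RCompr b (map_raw_pred (transpose b c) X))"
      using RCompr assms by (intro alpha_p_alpha_s.rename_Compr) auto
    then show ?thesis using 3 by (simp add: alpha_p_alpha_s.sym_s)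
  next
    case 4
    then show ?thesis using RCompr by (simp add: alpha_p_alpha_s.cong_Compr)
  qed
qed (auto intro: alpha_p_alpha_s.intros)

lemma beth_infinite: "card_beth_omega (A :: 'a set) \<Longrightarrow> infinite A"
  unfolding card_beth_omega_def
  by (metis UNIV_I UN_upper eqpoll_finite_iff finite_subset infinite_UNIV_nat)

lemma small_subset: "small S \<Longrightarrow> R \<subseteq> S \<Longrightarrow> small R"
  unfolding small_def using lesspoll_trans1 subset_imp_lepoll by blast

lemma infinite_atoms: "infinite (atoms i)"
  using card_level beth_infinite unfolding atoms_def by blast

lemma small_insert: "small S \<Longrightarrow> small (insert a S)"
  unfolding small_def
  by (metis beth_infinite eq_lesspoll_trans finite_insert finite_lesspoll_infinite infinite_insert_eqpoll)

lemma small_Un_finite: "finite F \<Longrightarrow> small S \<Longrightarrow> small (F \<union> S)"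
  by (induct F rule: finite_induct) (auto intro: small_insert)

lemma New_mono_finite:
  assumes "New i \<Phi>" "finite F" "\<And>a. a \<in> atoms i \<Longrightarrow> a \<notin> F \<Longrightarrow> \<Phi> a \<Longrightarrow> \<Psi> a"
  shows "New i \<Psi>"
  unfolding New_def
proof (rule small_subset)
  show "small (F \<union> (atoms i - {a' \<in> atoms i. \<Phi> a'}))"
    using assms(1,2) by (simp add: New_def small_Un_finite)
  show "atoms i - {a' \<in> atoms i. \<Psi> a'} \<subseteq> F \<union> (atoms i - {a' \<in> atoms i. \<Phi> a'})"
    using assms(3) by auto
qed

lemma New_cong_finite:
  assumes "finite F" "\<And>a. a \<in> atoms i \<Longrightarrow> a \<notin> F \<Longrightarrow> \<Phi> a \<longleftrightarrow> \<Psi> a"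
  shows "New i \<Phi> \<longleftrightarrow> New i \<Psi>"
  using New_mono_finite[of i \<Phi> F \<Psi>] New_mono_finite[of i \<Psi> F \<Phi>] assms by metis

lemma rvalid_cong_fresh:
  "renaming \<sigma> \<Longrightarrow> level b = level c \<Longrightarrow> b \<notin> rfree_p X \<Longrightarrow> c \<notin> rfree_p X \<Longrightarrow>
    rvalid p (map_raw_pred \<sigma> (map_raw_pred (transpose b c) X)) = rvalid p (map_raw_pred \<sigma> X)"
proof (induct "size X" arbitrary: X b c \<sigma> rule: less_induct)
  case less
  show ?case
  proof (cases X)
    case (RConj Xs)
    then have "rvalid p (map_raw_pred \<sigma> (map_raw_pred (transpose b c) Y)) = rvalid p (map_raw_pred \<sigma> Y)"
      if "Y |\<in>| Xs" for Y
      using less.hyps[OF _ less.prems(1,2), of Y] less.prems size_RConj[OF that] that by auto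
    then show ?thesis using RConj by simp
  next
    case (RNeg Y)
    then show ?thesis using less by simp
  next
    case (RElt y a)
    have "abs_iset (map_raw_set \<sigma> (map_raw_set (transpose b c) y)) = abs_iset (map_raw_set \<sigma> y)"
      using less.prems RElt unfolding iset.abs_eq_iff
      by (intro alpha_map alpha_fresh) auto
    then show ?thesis using RElt less.prems by (auto simp: transpose_def)
  next
    case (RAll d Y)
    have key: "(rvalid p (map_raw_pred \<sigma> X) = rvalid p (map_raw_pred \<sigma> (map_raw_pred (transpose e c) X)))"
      if "d = e" "e \<noteq> c" "level e = level c" "c \<notin> rfree_p X" for e c
    proof -
      let ?F = "{\<sigma> e, \<sigma> c} \<union> \<sigma> ` rfree_p Y"
      have fin: "finite ?F" by (simp add: finite_rfree)
      have cY: "c \<notin> rfree_p Y" using that RAll by auto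
      have "New (level (\<sigma> e)) (\<lambda>a'. rvalid p (map_raw_pred (transpose a' (\<sigma> e)) (map_raw_pred \<sigma> Y)))
        = New (level (\<sigma> e)) (\<lambda>a'. rvalid p (map_raw_pred (transpose a' (\<sigma> c)) (map_raw_pred \<sigma> (map_raw_pred (transpose e c) Y))))"
      proof (rule New_cong_finite[OF fin])
        fix a' assume a': "a' \<in> atoms (level (\<sigma> e))" "a' \<notin> ?F"
        obtain f where f: "a' = \<sigma> f" using less.prems(1) by (metis renaming_def bij_pointE)
        have lf: "level f = level e"
          using a' f less.prems(1) by (auto simp: atoms_def renaming_def)
        have ne: "f \<noteq> e" "f \<noteq> c" "f \<notin> rfree_p Y" using a' f by auto
        have s: "inj \<sigma>" using less.prems good_inj by auto
        let ?\<tau> = "transpose a' (\<sigma> e) \<circ> \<sigma>"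
        have g: "renaming ?\<tau>" using a' less.prems by (intro good_comp good_transpose) (auto simp: atoms_def)
        have "rvalid p (map_raw_pred ?\<tau> (map_raw_pred (transpose f c) Y)) = rvalid p (map_raw_pred ?\<tau> Y)"
          using RAll g lf that ne cY by (intro less.hyps) auto
        moreover have "?\<tau> \<circ> transpose f c = transpose a' (\<sigma> c) \<circ> \<sigma> \<circ> transpose e c"
          using s ne that by (auto simp: fun_eq_iff transpose_def f inj_eq)
        ultimately show "rvalid p (map_raw_pred (transpose a' (\<sigma> e)) (map_raw_pred \<sigma> Y)) =
          rvalid p (map_raw_pred (transpose a' (\<sigma> c)) (map_raw_pred \<sigma> (map_raw_pred (transpose e c) Y)))"
          by (simp add: raw_pred.map_comp o_assoc)
      qed
      moreover have "level (\<sigma> e) = level (\<sigma> c)" using that less.prems by (simp add: renaming_def)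
      ultimately show ?thesis using that RAll by simp
    qed
    consider "b = c" | "b \<noteq> c" "d = b" | "b \<noteq> c" "d = c" | "d \<noteq> b" "d \<noteq> c" by blast
    then show ?thesis
    proof cases
      case 1
      then show ?thesis by (simp add: transpose_same raw_pred.map_id0 id_def[symmetric])
    next
      case 2
      then show ?thesis using key[of b c] less.prems by auto
    next
      case 3
      then show ?thesis using key[of c b] less.prems by (auto simp: transpose_commute)
    next
      case 4
      have "rvalid p (map_raw_pred (transpose a' (\<sigma> d)) (map_raw_pred \<sigma> (map_raw_pred (transpose b c) Y)))
         = rvalid p (map_raw_pred (transpose a' (\<sigma> d)) (map_raw_pred \<sigma> Y))" if "a' \<in> atoms (level (\<sigma> d))" for a'
      proof -
        have "renaming (transpose a' (\<sigma> d) \<circ> \<sigma>)" using that less.prems by (auto simp: atoms_def intro!: good_comp good_transpose)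
        then show ?thesis
        using less.hyps[of Y "transpose a' (\<sigma> d) \<circ> \<sigma>" b c] RAll less.prems 4
        by (simp add: raw_pred.map_comp o_assoc)
      qed
      then have "New (level (\<sigma> d)) (\<lambda>a'. rvalid p (map_raw_pred (transpose a' (\<sigma> d)) (map_raw_pred \<sigma> (map_raw_pred (transpose b c) Y))))
        = New (level (\<sigma> d)) (\<lambda>a'. rvalid p (map_raw_pred (transpose a' (\<sigma> d)) (map_raw_pred \<sigma> Y)))"
        by (intro New_cong_finite[of "{}"]) auto
      then show ?thesis using RAll 4 by simp
    qed
  qed
qed

lemma rvalid_alpha:
  fixes X Y :: "'a::atom raw_pred" and x y :: "'a raw_set"
  shows "alpha_p X Y \<Longrightarrow> renaming \<pi> \<Longrightarrow> rvalid p (map_raw_pred \<pi> X) = rvalid p (map_raw_pred \<pi> Y)"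
    and "alpha_s x y \<Longrightarrow> True"
proof (induct arbitrary: \<pi> and rule: alpha_p_alpha_s.inducts)
  case (cong_Conj Xs Ys)
  then show ?case by (fastforce simp: rel_fset_alt_def)
next
  case (cong_All X Y a)
  have "rvalid p (map_raw_pred (transpose a' (\<pi> a)) (map_raw_pred \<pi> X)) = rvalid p (map_raw_pred (transpose a' (\<pi> a)) (map_raw_pred \<pi> Y))"
      if "a' \<in> atoms (level (\<pi> a))" for a'
  proof -
    have "renaming (transpose a' (\<pi> a) \<circ> \<pi>)" using that cong_All.prems by (auto simp: atoms_def intro!: good_comp good_transpose)
    then show ?thesis using cong_All.hyps(2) by (simp add: raw_pred.map_comp)
  qed
  then show ?case using New_cong_finite[of "{}" "level (\<pi> a)" "\<lambda>a'. rvalid p (map_raw_pred (transpose a' (\<pi> a)) (map_raw_pred \<pi> X))"]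
    by simp
next
  case (cong_Elt x y a)
  then have "abs_iset (map_raw_set \<pi> x) = abs_iset (map_raw_set \<pi> y)"
    unfolding iset.abs_eq_iff by (intro alpha_map)
  then show ?case by simp
next
  case (rename_All b a X)
  show ?case
  proof (cases "a = b")
    case False
    have "alpha_p (RAll a X) (RAll b (map_raw_pred (transpose b a) X))"
      using rename_All by (simp add: alpha_p_alpha_s.rename_All)
    then have "b \<notin> rfree_p (RAll a X)" "a \<notin> rfree_p (RAll a X)" using rename_All by auto
    from rvalid_cong_fresh[OF rename_All(3) rename_All(1) this, of p]
    show ?thesis by simp
  qed (simp add: transpose_same raw_pred.map_id0 id_def[symmetric])
qed auto

lemma valid_abs: "abs_ipred X = Y \<Longrightarrow> p \<Turnstile> Y \<longleftrightarrow> rvalid p X"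
proof -
  assume "abs_ipred X = Y"
  then have "alpha_p (rep_ipred Y) X"
    by (metis Quotient3_ipred Quotient3_rel_rep Quotient3_abs_rep ipred.abs_eq_iff)
  from rvalid_alpha(1)[OF this good_id(1), of p] show ?thesis
    by (simp add: valid_def raw_pred.map_id0 raw_pred.map_id)
qed

lemma ren_p_abs: "renaming \<pi> \<Longrightarrow> ren_p \<pi> (abs_ipred X) = abs_ipred (map_raw_pred \<pi> X)"
  unfolding ren_p_def ipred.abs_eq_iff
  by (intro alpha_map) (metis Quotient3_ipred Quotient3_abs_rep ipred.abs_eq_iff)

lemma ren_s_abs: "renaming \<pi> \<Longrightarrow> ren_s \<pi> (abs_iset x) = abs_iset (map_raw_set \<pi> x)"
  unfolding ren_s_def iset.abs_eq_iff
  by (intro alpha_map) (metis Quotient3_iset Quotient3_abs_rep iset.abs_eq_iff)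

lemma free_p_abs: "free_p (abs_ipred X) = rfree_p X"
  unfolding free_p_def
  by (intro rfree_alpha) (metis Quotient3_ipred Quotient3_abs_rep ipred.abs_eq_iff)

lemma free_s_abs: "free_s (abs_iset x) = rfree_s x"
  unfolding free_s_def
  by (intro rfree_alpha) (metis Quotient3_iset Quotient3_abs_rep iset.abs_eq_iff)

lemma ipred_abs_exhaust: obtains X where "(Z::'a::atom ipred) = abs_ipred X"
  by (metis Quotient3_ipred Quotient3_abs_rep)
lemma iset_abs_exhaust: obtains x where "(z::'a::atom iset) = abs_iset x"
  by (metis Quotient3_iset Quotient3_abs_rep)
lemma fset_abs_exhaust: obtains Ys where "(Xs::'a::atom ipred fset) = abs_ipred |`| Ys"
proof
  show "Xs = abs_ipred |`| (rep_ipred |`| Xs)"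
    by (simp add: fset.map_comp comp_def Quotient3_abs_rep[OF Quotient3_ipred])
qed

lemma abs_Conj: "Conj (abs_ipred |`| Xs) = abs_ipred (RConj Xs)"
  by (simp add: Conj.abs_eq)

lemmas abs_con = abs_Conj[symmetric] Neg.abs_eq[symmetric] Forall.abs_eq[symmetric] Elt.abs_eq[symmetric]
  Atm_def[symmetric] Compr.abs_eq[symmetric]

lemma ren_simps:
  assumes "renaming \<pi>"
  shows "ren_p \<pi> (Conj Xs) = Conj (ren_p \<pi> |`| Xs)"
    "ren_p \<pi> (Neg X) = Neg (ren_p \<pi> X)"
    "ren_p \<pi> (Forall a X) = Forall (\<pi> a) (ren_p \<pi> X)"
    "ren_p \<pi> (Elt x a) = Elt (ren_s \<pi> x) (\<pi> a)"
    "ren_s \<pi> (Atm a) = Atm (\<pi> a)"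
    "ren_s \<pi> (Compr a X) = Compr (\<pi> a) (ren_p \<pi> X)"
proof -
  obtain Ys where Y: "Xs = abs_ipred |`| Ys" by (rule fset_abs_exhaust)
  obtain X' where X: "X = abs_ipred X'" by (rule ipred_abs_exhaust)
  obtain x' where x: "x = abs_iset x'" by (rule iset_abs_exhaust)
  have *: "ren_p \<pi> |`| Xs = abs_ipred |`| (map_raw_pred \<pi> |`| Ys)"
    using assms by (simp add: Y fset.map_comp comp_def ren_p_abs)
  show "ren_p \<pi> (Conj Xs) = Conj (ren_p \<pi> |`| Xs)"
    unfolding * unfolding abs_Conj Y ren_p_abs[OF assms] by simp
  show     "ren_p \<pi> (Neg X) = Neg (ren_p \<pi> X)"
    "ren_p \<pi> (Forall a X) = Forall (\<pi> a) (ren_p \<pi> X)"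
    "ren_p \<pi> (Elt x a) = Elt (ren_s \<pi> x) (\<pi> a)"
    "ren_s \<pi> (Atm a) = Atm (\<pi> a)"
    "ren_s \<pi> (Compr a X) = Compr (\<pi> a) (ren_p \<pi> X)"
    using assms by (simp_all add: X x Neg.abs_eq Forall.abs_eq Elt.abs_eq Atm.abs_eq Compr.abs_eq ren_p_abs ren_s_abs)
qed

lemma free_simps:
  shows "free_p (Conj Xs) = \<Union> (fset (free_p |`| Xs))"
    "free_p (Neg X) = free_p X"
    "free_p (Forall a X) = free_p X - {a}"
    "free_p (Elt x a) = insert a (free_s x)"
    "free_s (Atm a) = {a}"
    "free_s (Compr a X) = free_p X - {a}"
proof -
  obtain Ys where Y: "Xs = abs_ipred |`| Ys" by (rule fset_abs_exhaust)
  obtain X' where X: "X = abs_ipred X'" by (rule ipred_abs_exhaust)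
  obtain x' where x: "x = abs_iset x'" by (rule iset_abs_exhaust)
  show "free_p (Conj Xs) = \<Union> (fset (free_p |`| Xs))"
    unfolding abs_Conj Y free_p_abs by (simp add: free_p_abs)
  show "free_p (Neg X) = free_p X"
    "free_p (Forall a X) = free_p X - {a}"
    "free_p (Elt x a) = insert a (free_s x)"
    "free_s (Atm a) = {a}"
    "free_s (Compr a X) = free_p X - {a}"
    by (simp_all add: X x Neg.abs_eq Forall.abs_eq Elt.abs_eq Atm.abs_eq Compr.abs_eq free_p_abs free_s_abs)
qed

lemma valid_simps:
    "p \<Turnstile> Conj Xs \<longleftrightarrow> (\<forall>X. X |\<in>| Xs \<longrightarrow> p \<Turnstile> X)"
    "p \<Turnstile> Neg X \<longleftrightarrow> \<not> p \<Turnstile> X"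
    "p \<Turnstile> Forall a X \<longleftrightarrow> New (level a) (\<lambda>a'. p \<Turnstile> ren_p (transpose a' a) X)"
    "p \<Turnstile> Elt y a \<longleftrightarrow> (a, y) \<in> p"
proof -
  obtain Ys where Y: "Xs = abs_ipred |`| Ys" by (rule fset_abs_exhaust)
  obtain X' where X: "X = abs_ipred X'" by (rule ipred_abs_exhaust)
  obtain x' where x: "y = abs_iset x'" by (rule iset_abs_exhaust)
  have v: "p \<Turnstile> abs_ipred X \<longleftrightarrow> rvalid p X" for X using valid_abs by blast
  show "p \<Turnstile> Conj Xs \<longleftrightarrow> (\<forall>X. X |\<in>| Xs \<longrightarrow> p \<Turnstile> X)"
    by (auto simp: abs_Conj Y v)
  show     "p \<Turnstile> Neg X \<longleftrightarrow> \<not> p \<Turnstile> X"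
    "p \<Turnstile> Elt y a \<longleftrightarrow> (a, y) \<in> p"
    by (simp_all add: X x Neg.abs_eq Elt.abs_eq v)
  have "p \<Turnstile> ren_p (transpose a' a) X \<longleftrightarrow> rvalid p (map_raw_pred (transpose a' a) X')" if "a' \<in> atoms (level a)" for a'
  proof -
    have "renaming (transpose a' a)" using that by (auto simp: atoms_def intro: good_transpose)
    then show ?thesis by (simp add: X ren_p_abs v)
  qed
  then show "p \<Turnstile> Forall a X \<longleftrightarrow> New (level a) (\<lambda>a'. p \<Turnstile> ren_p (transpose a' a) X)"
    using New_cong_finite[of "{}" "level a" "\<lambda>a'. p \<Turnstile> ren_p (transpose a' a) X" "\<lambda>a'. rvalid p (map_raw_pred (transpose a' a) X')"]
    by (simp add: X Forall.abs_eq v)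
qed

definition abs_rel :: "'a::atom \<Rightarrow> 'a raw_pred \<Rightarrow> 'a \<Rightarrow> 'a raw_pred \<Rightarrow> bool" where
  "abs_rel a X b Y \<longleftrightarrow> level a = level b \<and> (\<exists>F. finite F \<and> (\<forall>c. c \<notin> F \<longrightarrow> level c = level a \<longrightarrow>
     alpha_p (map_raw_pred (transpose c a) X) (map_raw_pred (transpose c b) Y)))"

fun head_p :: "'a::atom raw_pred \<Rightarrow> 'a raw_pred \<Rightarrow> bool" where
  "head_p (RConj Xs) (RConj Ys) \<longleftrightarrow> rel_fset alpha_p Xs Ys"
| "head_p (RNeg X) (RNeg Y) \<longleftrightarrow> alpha_p X Y"
| "head_p (RAll a X) (RAll b Y) \<longleftrightarrow> abs_rel a X b Y"
| "head_p (RElt x a) (RElt y b) \<longleftrightarrow> alpha_s x y \<and> a = b"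
| "head_p _ _ \<longleftrightarrow> False"

fun head_s :: "'a::atom raw_set \<Rightarrow> 'a raw_set \<Rightarrow> bool" where
  "head_s (RAtm a) (RAtm b) \<longleftrightarrow> a = b"
| "head_s (RCompr a X) (RCompr b Y) \<longleftrightarrow> abs_rel a X b Y"
| "head_s _ _ \<longleftrightarrow> False"

lemma abs_rel_cong: "alpha_p X Y \<Longrightarrow> abs_rel a X a Y"
  unfolding abs_rel_def
  by (auto intro!: exI[of _ "{}"] alpha_map good_transpose)

lemma abs_rel_sym: "abs_rel a X b Y \<Longrightarrow> abs_rel b Y a X"
  unfolding abs_rel_def by (metis sym_p)

lemma abs_rel_trans: "abs_rel a X b Y \<Longrightarrow> abs_rel b Y c Z \<Longrightarrow> abs_rel a X c Z"
  unfolding abs_rel_def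
  apply (elim conjE exE)
  subgoal for F G
    by (auto intro!: exI[of _ "F \<union> G"] intro: trans_p)
  done

lemma abs_rel_rename:
  assumes "level b = level a" "b \<notin> rfree_p X"
  shows "abs_rel a X b (map_raw_pred (transpose b a) X)"
  unfolding abs_rel_def
proof (intro conjI exI[of _ "rfree_p X \<union> {a,b}"] allI impI)
  fix c assume c: "c \<notin> rfree_p X \<union> {a,b}" "level c = level a"
  show "alpha_p (map_raw_pred (transpose c a) X) (map_raw_pred (transpose c b) (map_raw_pred (transpose b a) X))"
  proof (cases "a = b")
    case True
    then show ?thesis by (simp add: transpose_same raw_pred.map_id0 id_def[symmetric] refl_p)
  next
    case False
    have "transpose c b \<circ> transpose b a = transpose c a \<circ> transpose c b"
      using c False by (auto simp: fun_eq_iff transpose_def)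
    moreover have "alpha_p (map_raw_pred (transpose c a) (map_raw_pred (transpose c b) X)) (map_raw_pred (transpose c a) X)"
      using c assms by (intro alpha_map alpha_fresh good_transpose) auto
    ultimately show ?thesis by (simp add: raw_pred.map_comp sym_p)
  qed
qed (use assms in \<open>auto simp: finite_rfree\<close>)

lemma rel_alpha_sym: "rel_fset alpha_p Xs Ys \<Longrightarrow> rel_fset alpha_p Ys Xs"
  unfolding rel_fset_alt_def by (meson sym_p)
lemma rel_alpha_trans: "rel_fset alpha_p Xs Ys \<Longrightarrow> rel_fset alpha_p Ys Zs \<Longrightarrow> rel_fset alpha_p Xs Zs"
  unfolding rel_fset_alt_def by (meson trans_p)

lemma abs_rel_refl: "abs_rel a X a X" by (simp add: abs_rel_cong refl_p)
lemma head_refl: "head_p X X" "head_s x x"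
  by (cases X; auto simp: refl_p refl_s abs_rel_refl fset.rel_refl)
     (cases x; auto simp: refl_p refl_s abs_rel_refl)
lemma head_sym: "head_p X Y \<Longrightarrow> head_p Y X" "head_s x y \<Longrightarrow> head_s y x"
  by (cases X; cases Y; auto intro: sym_p sym_s rel_alpha_sym abs_rel_sym)
     (cases x; cases y; auto intro: abs_rel_sym)
lemma head_trans: "head_p X Y \<Longrightarrow> head_p Y Z \<Longrightarrow> head_p X Z" "head_s x y \<Longrightarrow> head_s y z \<Longrightarrow> head_s x z"
  by (cases X; cases Y; simp; cases Z; auto intro: trans_p trans_s rel_alpha_trans abs_rel_trans)
     (cases x; cases y; simp; cases z; auto intro: abs_rel_trans)

lemma alpha_head:
  fixes X Y :: "'a::atom raw_pred" and x y :: "'a raw_set"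
  shows "alpha_p X Y \<Longrightarrow> head_p X Y" and "alpha_s x y \<Longrightarrow> head_s x y"
proof (induct rule: alpha_p_alpha_s.inducts)
  case (cong_Conj Xs Ys)
  then show ?case by (simp add: rel_fset_alt_def) meson
qed (auto intro: head_refl head_sym head_trans abs_rel_rename abs_rel_cong)

lemma abs_p_eq: "abs_ipred X = abs_ipred Y \<longleftrightarrow> alpha_p X Y" by (rule ipred.abs_eq_iff)
lemma abs_s_eq: "abs_iset x = abs_iset y \<longleftrightarrow> alpha_s x y" by (rule iset.abs_eq_iff)

lemma abs_rel_quot: "abs_rel a X b Y \<Longrightarrow> level a = level b \<and> (\<exists>F. finite F \<and> (\<forall>c. c \<notin> F \<longrightarrow> level c = level a \<longrightarrow>
     ren_p (transpose c a) (abs_ipred X) = ren_p (transpose c b) (abs_ipred Y)))"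
  unfolding abs_rel_def by (auto simp: ren_p_abs good_transpose abs_p_eq)

lemma rel_fset_abs: "rel_fset alpha_p Xs Ys \<Longrightarrow> abs_ipred |`| Xs = abs_ipred |`| Ys"
proof -
  assume "rel_fset alpha_p Xs Ys"
  then have "rel_fset (\<lambda>X Y. abs_ipred X = abs_ipred Y) Xs Ys" by (simp add: abs_p_eq)
  then have "rel_fset (=) (abs_ipred |`| Xs) (abs_ipred |`| Ys)" by (simp add: fset.rel_map)
  then show ?thesis by (simp add: fset.rel_eq)
qed

lemma con_inject:
  shows Conj_inject: "Conj Xs = Conj Ys \<longleftrightarrow> Xs = Ys"
    and Neg_inject: "Neg X = Neg Y \<longleftrightarrow> X = Y"
    and Elt_inject: "Elt x a = Elt y b \<longleftrightarrow> x = y \<and> a = b"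
    and Atm_inject: "Atm a = Atm b \<longleftrightarrow> a = b"
proof -
  obtain Xs' where Xs: "Xs = abs_ipred |`| Xs'" by (rule fset_abs_exhaust)
  obtain Ys' where Ys: "Ys = abs_ipred |`| Ys'" by (rule fset_abs_exhaust)
  obtain X' where X: "X = abs_ipred X'" by (rule ipred_abs_exhaust)
  obtain x' where x: "x = abs_iset x'" by (rule iset_abs_exhaust)
  obtain Y' where Y: "Y = abs_ipred Y'" by (rule ipred_abs_exhaust)
  obtain y' where y: "y = abs_iset y'" by (rule iset_abs_exhaust)
  show "Conj Xs = Conj Ys \<longleftrightarrow> Xs = Ys"
    unfolding Xs Ys abs_Conj abs_p_eq using alpha_head(1)[of "RConj Xs'" "RConj Ys'"] rel_fset_abs[of Xs' Ys']
    by (metis abs_Conj abs_p_eq head_p.simps(1))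
  show "Neg X = Neg Y \<longleftrightarrow> X = Y"
    unfolding X Y Neg.abs_eq abs_p_eq using alpha_head(1)[of "RNeg X'" "RNeg Y'"] by (auto intro: cong_Neg)
  show "Elt x a = Elt y b \<longleftrightarrow> x = y \<and> a = b"
    unfolding x y Elt.abs_eq abs_p_eq abs_s_eq using alpha_head(1)[of "RElt x' a" "RElt y' b"] by (auto intro: cong_Elt)
  show "Atm a = Atm b \<longleftrightarrow> a = b"
    unfolding Atm.abs_eq abs_s_eq using alpha_head(2)[of "RAtm a" "RAtm b"] by (auto intro: refl_s)
qed

lemma con_distinct:
  shows "Conj Xs \<noteq> Neg Y" "Conj Xs \<noteq> Forall a Y" "Conj Xs \<noteq> Elt x a"
   "Neg X \<noteq> Forall a Y" "Neg X \<noteq> Elt x a" "Forall b X \<noteq> Elt x a" "Atm a \<noteq> Compr b X"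
proof -
  obtain Xs' where Xs: "Xs = abs_ipred |`| Xs'" by (rule fset_abs_exhaust)
  obtain X' where X: "X = abs_ipred X'" by (rule ipred_abs_exhaust)
  obtain Y' where Y: "Y = abs_ipred Y'" by (rule ipred_abs_exhaust)
  obtain x' where x: "x = abs_iset x'" by (rule iset_abs_exhaust)
  show "Conj Xs \<noteq> Neg Y" "Conj Xs \<noteq> Forall a Y" "Conj Xs \<noteq> Elt x a"
   "Neg X \<noteq> Forall a Y" "Neg X \<noteq> Elt x a" "Forall b X \<noteq> Elt x a" "Atm a \<noteq> Compr b X"
    unfolding Xs X Y x abs_Conj Neg.abs_eq Elt.abs_eq Forall.abs_eq Atm.abs_eq Compr.abs_eq abs_p_eq abs_s_eq
    by (auto dest: alpha_head)
qed

lemma ren_comp: "renaming \<pi> \<Longrightarrow> renaming \<sigma> \<Longrightarrow> ren_p \<pi> (ren_p \<sigma> X) = ren_p (\<pi> \<circ> \<sigma>) X"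
  "renaming \<pi> \<Longrightarrow> renaming \<sigma> \<Longrightarrow> ren_s \<pi> (ren_s \<sigma> x) = ren_s (\<pi> \<circ> \<sigma>) x"
   apply (rule ipred_abs_exhaust[of X])
   apply (simp add: ren_p_abs good_comp raw_pred.map_comp)
  apply (rule iset_abs_exhaust[of x])
  apply (simp add: ren_s_abs good_comp raw_set.map_comp)
  done

lemma ren_id: "ren_p id X = X" "ren_s id x = x"
   apply (rule ipred_abs_exhaust[of X])
   apply (simp add: ren_p_abs good_id raw_pred.map_id)
  apply (rule iset_abs_exhaust[of x])
  apply (simp add: ren_s_abs good_id raw_set.map_id)
  done

lemma free_ren:
  assumes "renaming \<pi>"
  shows "free_p (ren_p \<pi> X) = \<pi> ` free_p X"
   "free_s (ren_s \<pi> x) = \<pi> ` free_s x"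
  using good_inj[OF assms] assms
   apply -
   apply (rule ipred_abs_exhaust[of X])
   apply (simp add: ren_p_abs free_p_abs rfree_map)
  apply (rule iset_abs_exhaust[of x])
  apply (simp add: ren_s_abs free_s_abs rfree_map)
  done

lemma finite_free: "finite (free_p X)" "finite (free_s x)"
  by (simp_all add: free_p_def free_s_def finite_rfree)

lemma ren_fresh:
  assumes "level b = level c"
  shows "b \<notin> free_p X \<Longrightarrow> c \<notin> free_p X \<Longrightarrow> ren_p (transpose b c) X = X"
    "b \<notin> free_s x \<Longrightarrow> c \<notin> free_s x \<Longrightarrow> ren_s (transpose b c) x = x"
  using alpha_fresh[OF assms] good_transpose[OF assms]
   apply -
   apply (rule ipred_abs_exhaust[of X])
   apply (simp add: ren_p_abs free_p_abs abs_p_eq)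
  apply (rule iset_abs_exhaust[of x])
  apply (simp add: ren_s_abs free_s_abs abs_s_eq)
  done

lemma transpose_twice: "level a = level b \<Longrightarrow> ren_p (transpose a b) (ren_p (transpose a b) X) = X"
  "level a = level b \<Longrightarrow> ren_s (transpose a b) (ren_s (transpose a b) x) = x"
  by (simp_all add: ren_comp good_transpose ren_id)

lemma All_rename: "level b = level a \<Longrightarrow> b \<notin> free_p X - {a} \<Longrightarrow> Forall a X = Forall b (ren_p (transpose b a) X)"
  and Compr_rename: "level b = level a \<Longrightarrow> b \<notin> free_p X - {a} \<Longrightarrow> Compr a X = Compr b (ren_p (transpose b a) X)"
  for a :: "'a::atom"
proof -
  assume l: "level b = level a" and b: "b \<notin> free_p X - {a}"
  obtain X' where X: "X = abs_ipred X'" by (rule ipred_abs_exhaust)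
  have "Forall a X = Forall b (ren_p (transpose b a) X) \<and> Compr a X = Compr b (ren_p (transpose b a) X)"
  proof (cases "a = b")
    case True
    then show ?thesis by (simp add: transpose_same ren_id)
  next
    case False
    then show ?thesis using l b
      by (simp add: X Forall.abs_eq Compr.abs_eq ren_p_abs good_transpose abs_p_eq abs_s_eq free_p_abs rename_All rename_Compr)
  qed
  then show "Forall a X = Forall b (ren_p (transpose b a) X)" "Compr a X = Compr b (ren_p (transpose b a) X)" by auto
qed

lemma abs_inject_aux:
  assumes "finite F" "level a = level b" "\<And>c. c \<notin> F \<Longrightarrow> level c = level a \<Longrightarrow> ren_p (transpose c a) X = ren_p (transpose c b) Y"
    "free_p X - {a} = free_p Y - {b}"
  shows "Y = ren_p (transpose b a) X \<and> b \<notin> free_p X - {a}"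
proof -
  have "finite (F \<union> free_p X \<union> free_p Y \<union> {a,b})" using assms finite_free by blast
  then obtain c where c: "c \<in> atoms (level a)" "c \<notin> F \<union> free_p X \<union> free_p Y \<union> {a,b}"
    using infinite_atoms by (metis finite_subset subsetI)
  then have lc: "level c = level a" by (simp add: atoms_def)
  have "Y = ren_p (transpose c b) (ren_p (transpose c a) X)"
    using assms(3)[of c] c lc transpose_twice(1)[of c b Y] assms(2) by simp
  also have "\<dots> = ren_p (transpose b a) X"
  proof (cases "a = b")
    case True then show ?thesis using lc by (simp add: transpose_twice ren_id)
  next
    case False
    have "b \<notin> free_p X" using assms(4) False by auto
    have "transpose c b \<circ> transpose c a = transpose b a \<circ> transpose c b"
      using c False by (auto simp: fun_eq_iff transpose_def)
    then have "ren_p (transpose c b) (ren_p (transpose c a) X) = ren_p (transpose b a) (ren_p (transpose c b) X)"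
      using lc assms(2) by (simp add: ren_comp good_transpose)
    also have "ren_p (transpose c b) X = X" using c lc assms(2) \<open>b \<notin> free_p X\<close> by (intro ren_fresh) auto
    finally show ?thesis .
  qed
  finally show ?thesis using assms(4) by blast
qed

lemma All_inject: "Forall a X = Forall b Y \<Longrightarrow> level a = level b \<and> Y = ren_p (transpose b a) X \<and> b \<notin> free_p X - {a}"
proof -
  assume *: "Forall a X = Forall b Y"
  obtain X' where X: "X = abs_ipred X'" by (rule ipred_abs_exhaust)
  obtain Y' where Y: "Y = abs_ipred Y'" by (rule ipred_abs_exhaust)
  have "abs_rel a X' b Y'" using * alpha_head(1)[of "RAll a X'" "RAll b Y'"] by (simp add: X Y Forall.abs_eq abs_p_eq)
  then obtain F where F: "finite F" "level a = level b"
    "\<And>c. c \<notin> F \<Longrightarrow> level c = level a \<Longrightarrow> ren_p (transpose c a) X = ren_p (transpose c b) Y"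
    unfolding X Y by (blast dest: abs_rel_quot)
  have "free_p X - {a} = free_p Y - {b}" using arg_cong[OF *, of free_p] by (simp only: free_simps)
  from abs_inject_aux[OF F this] F(2) show ?thesis by blast
qed

lemma Compr_inject: "Compr a X = Compr b Y \<Longrightarrow> level a = level b \<and> Y = ren_p (transpose b a) X \<and> b \<notin> free_p X - {a}"
proof -
  assume *: "Compr a X = Compr b Y"
  obtain X' where X: "X = abs_ipred X'" by (rule ipred_abs_exhaust)
  obtain Y' where Y: "Y = abs_ipred Y'" by (rule ipred_abs_exhaust)
  have "abs_rel a X' b Y'" using * alpha_head(2)[of "RCompr a X'" "RCompr b Y'"] by (simp add: X Y Compr.abs_eq abs_s_eq)
  then obtain F where F: "finite F" "level a = level b"
    "\<And>c. c \<notin> F \<Longrightarrow> level c = level a \<Longrightarrow> ren_p (transpose c a) X = ren_p (transpose c b) Y"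
    unfolding X Y by (blast dest: abs_rel_quot)
  have "free_p X - {a} = free_p Y - {b}" using arg_cong[OF *, of free_s] by (simp only: free_simps)
  from abs_inject_aux[OF F this] F(2) show ?thesis by blast
qed

lemma fresh_atom_exists:
  assumes "finite (F::'a::atom set)" obtains c where "c \<notin> F" "level c = i"
proof -
  obtain c where "c \<in> atoms i" "c \<notin> F"
    using infinite_atoms[of i, where 'a='a] finite_subset[OF _ assms] by blast
  then show ?thesis using that by (simp add: atoms_def)
qed

lemma fresh_atom_spec:
  assumes "finite (F::'a::atom set)" shows "fresh_atom i F \<notin> F" "level (fresh_atom i F) = i"
proof -
  obtain c where "c \<notin> F" "level c = i" by (rule fresh_atom_exists[OF assms])
  then have "fresh_atom i F \<in> atoms i \<and> fresh_atom i F \<notin> F"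
    using someI[of "\<lambda>b. b \<in> atoms i \<and> b \<notin> F" c] unfolding fresh_atom_def by (simp add: atoms_def)
  then show "fresh_atom i F \<notin> F" "level (fresh_atom i F) = i" by (auto simp: atoms_def)
qed

lemma fset_image_comp: "f |`| (g |`| Xs) = (f \<circ> g) |`| Xs" by (rule fset.map_comp)

lemma good_inv: "renaming \<pi> \<Longrightarrow> renaming (inv \<pi>)"
  unfolding renaming_def by (metis bij_imp_bij_inv bij_inv_eq_iff)

lemma ren_inv: "renaming \<pi> \<Longrightarrow> ren_p (inv \<pi>) (ren_p \<pi> X) = X" "renaming \<pi> \<Longrightarrow> ren_s (inv \<pi>) (ren_s \<pi> x) = x"
  by (simp_all add: ren_comp good_inv good_inj ren_id)

lemma subst_rel_equivariant:
  fixes Z W :: "'a::atom ipred" and z w x :: "'a iset"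
  shows "subst_p_rel Z a x W \<Longrightarrow> renaming \<pi> \<Longrightarrow> subst_p_rel (ren_p \<pi> Z) (\<pi> a) (ren_s \<pi> x) (ren_p \<pi> W)"
    and "subst_s_rel z a x w \<Longrightarrow> renaming \<pi> \<Longrightarrow> subst_s_rel (ren_s \<pi> z) (\<pi> a) (ren_s \<pi> x) (ren_s \<pi> w)"
proof (induct rule: subst_p_rel_subst_s_rel.inducts)
  case (sub_Conj Xs a x f)
  let ?f = "ren_p \<pi> \<circ> f \<circ> ren_p (inv \<pi>)"
  have "subst_p_rel (Conj (ren_p \<pi> |`| Xs)) (\<pi> a) (ren_s \<pi> x) (Conj (?f |`| (ren_p \<pi> |`| Xs)))"
    using sub_Conj by (intro subst_p_rel_subst_s_rel.sub_Conj) (auto simp: ren_inv)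
  moreover have "?f |`| (ren_p \<pi> |`| Xs) = ren_p \<pi> |`| (f |`| Xs)"
    using sub_Conj.prems by (simp add: fset.map_comp comp_def ren_inv)
  ultimately show ?case using sub_Conj by (simp only: ren_simps)
qed (auto simp: ren_simps free_ren good_inj inj_eq inj_image_mem_iff intro!: subst_p_rel_subst_s_rel.intros)

lemma subst_rel_free:
  fixes Z W :: "'a::atom ipred" and z w x :: "'a iset"
  shows "subst_p_rel Z a x W \<Longrightarrow> free_p W \<subseteq> free_p Z - {a} \<union> free_s x"
    and "subst_s_rel z a x w \<Longrightarrow> free_s w \<subseteq> free_s z - {a} \<union> free_s x"
  by (induct rule: subst_p_rel_subst_s_rel.inducts) (auto simp: free_simps)

lemmas con_simps = con_inject con_distinct con_distinct[symmetric]

lemma ren_eq_same: "level a = level b \<Longrightarrow> Y = ren_p (transpose b a) X \<Longrightarrow> X = ren_p (transpose b a) Y"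
  by (simp add: transpose_twice)

lemma subst_rel_unique:
  fixes Z W :: "'a::atom ipred" and z w x :: "'a iset"
  shows "subst_p_rel Z a x W \<Longrightarrow> subst_p_rel Z a x W' \<Longrightarrow> W = W'"
    and "subst_s_rel z a x w \<Longrightarrow> subst_s_rel z a x w' \<Longrightarrow> w = w'"
proof (induct arbitrary: W' and w' rule: subst_p_rel_subst_s_rel.inducts)
  case (sub_Conj Xs a x f)
  note IH = sub_Conj.hyps and PR = sub_Conj.prems
  from PR show ?case
  proof cases
    case (sub_Conj Ys g)
    then have "Ys = Xs" by (simp add: con_simps)
    then have "f |`| Xs = g |`| Ys"
      using sub_Conj IH by (auto intro!: fset.map_cong)
    then show ?thesis using sub_Conj by simp
  qed (simp_all add: con_simps)
next
  case (sub_Neg X a x X')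
  note IH = sub_Neg.hyps
  from sub_Neg.prems show ?case
    by cases (insert IH(1), simp_all add: con_simps, (metis IH)?)
next
  case (sub_All b a x X X')
  note IH = sub_All.hyps and PR = sub_All.prems
  from PR show ?case
  proof cases
    case (sub_All d Y Y')
    then have bd: "level b = level d" "Y = ren_p (transpose d b) X" "d \<notin> free_p X - {b}"
      using All_inject by metis+
    have "subst_p_rel (ren_p (transpose d b) Y) (transpose d b a) (ren_s (transpose d b) x) (ren_p (transpose d b) Y')"
      using subst_rel_equivariant(1)[OF sub_All(5)] bd good_transpose by metis
    moreover have "ren_s (transpose d b) x = x" "transpose d b a = a"
      using sub_All IH bd by (auto intro!: ren_fresh)
    moreover have "ren_p (transpose d b) Y = X" using bd by (simp add: transpose_twice)
    ultimately have "X' = ren_p (transpose d b) Y'" using IH by metis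
    then have "Y' = ren_p (transpose d b) X'" using bd by (simp add: transpose_twice)
    moreover have "d \<notin> free_p X' - {b}"
      using subst_rel_free(1)[OF IH(3)] bd(3) sub_All by auto
    ultimately show ?thesis using sub_All bd All_rename by metis
  qed (simp_all add: con_simps)
next
  case (sub_Elt_Atm y a n y')
  note IH = sub_Elt_Atm.hyps
  from sub_Elt_Atm.prems show ?case
    by cases (insert IH(1), simp_all add: con_simps, (metis IH)?)
next
  case (sub_Elt_Compr c a y X y' W)
  note IH = sub_Elt_Compr.hyps and PR = sub_Elt_Compr.prems
  from PR show ?case
  proof cases
    case (sub_Elt_Compr d y2 Y y2')
    then have cd: "level c = level d" "Y = ren_p (transpose d c) X" "d \<notin> free_p X - {c}"
      using Compr_inject by metis+
    have y: "y2 = y" using sub_Elt_Compr by (simp add: con_simps)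
    then have y': "y2' = y'" using IH sub_Elt_Compr by metis
    have "d \<notin> free_s y2" by (fact sub_Elt_Compr)
    then have dfr: "d \<notin> free_s y" unfolding y .
    have fr: "c \<notin> free_s y'" "d \<notin> free_s y'"
      using subst_rel_free(2)[OF IH(3)] IH(1,2) dfr cd(3)
      by (auto simp: free_simps)
    have "subst_p_rel Y d y2' W'" by (fact sub_Elt_Compr)
    then have dW: "subst_p_rel Y d y' W'" unfolding y' .
    from subst_rel_equivariant(1)[OF dW good_transpose[OF cd(1)[symmetric]]]
    have "subst_p_rel (ren_p (transpose d c) Y) (transpose d c d) (ren_s (transpose d c) y') (ren_p (transpose d c) W')" .
    moreover have "ren_s (transpose d c) y' = y'" using fr cd by (intro ren_fresh) auto
    moreover have "ren_p (transpose d c) Y = X" using cd by (simp add: transpose_twice)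
    ultimately have "subst_p_rel X c y' (ren_p (transpose d c) W')" by simp
    then have W: "W = ren_p (transpose d c) W'" by (rule IH(6))
    have "d \<notin> free_p W" if "d \<noteq> c"
      using subst_rel_free(1)[OF IH(5)] cd(3) fr that by auto
    moreover have "c \<notin> free_p W'" if "d \<noteq> c"
    proof -
      have "free_p W = transpose d c ` free_p W'" using W cd by (simp add: free_ren good_transpose)
      then show ?thesis using \<open>d \<noteq> c \<Longrightarrow> d \<notin> free_p W\<close> that by force
    qed
    moreover have "d \<notin> free_p W'"
    proof -
      have "free_p W' \<subseteq> free_p Y - {d} \<union> free_s y'" using subst_rel_free(1)[OF dW] .
      then show ?thesis using fr by auto
    qed
    ultimately have "ren_p (transpose d c) W' = W'"
      using ren_fresh(1)[OF cd(1)[symmetric], of W'] ren_id(1)[of W'] by (cases "d = c") (simp_all add: transpose_same)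
    then show ?thesis using W by (rule trans[rotated])
  qed (auto simp add: con_simps)
next
  case (sub_Elt_other b a y x y')
  note IH = sub_Elt_other.hyps
  from sub_Elt_other.prems show ?case
    by cases (insert IH(1), simp_all add: con_simps, (metis IH)?)
next
  case (sub_Atm a x)
  from sub_Atm.prems show ?case
    by cases (auto simp: con_simps)
next
  case (sub_Atm_other b a x)
  note IH = sub_Atm_other.hyps
  from sub_Atm_other.prems show ?case
    by cases (insert IH(1), simp_all add: con_simps, (metis IH)?)
next
  case (sub_Compr b a x X X')
  note IH = sub_Compr.hyps and PR = sub_Compr.prems
  from PR show ?case
  proof cases
    case (sub_Compr d Y Y')
    then have bd: "level b = level d" "Y = ren_p (transpose d b) X" "d \<notin> free_p X - {b}"
      using Compr_inject by metis+
    have "subst_p_rel (ren_p (transpose d b) Y) (transpose d b a) (ren_s (transpose d b) x) (ren_p (transpose d b) Y')"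
      using subst_rel_equivariant(1)[OF sub_Compr(5)] bd good_transpose by metis
    moreover have "ren_s (transpose d b) x = x" "transpose d b a = a"
      using sub_Compr IH bd by (auto intro!: ren_fresh)
    moreover have "ren_p (transpose d b) Y = X" using bd by (simp add: transpose_twice)
    ultimately have "X' = ren_p (transpose d b) Y'" using IH by metis
    then have "Y' = ren_p (transpose d b) X'" using bd by (simp add: transpose_twice)
    moreover have "d \<notin> free_p X' - {b}"
      using subst_rel_free(1)[OF IH(3)] bd(3) sub_Compr by auto
    ultimately show ?thesis using sub_Compr bd Compr_rename by metis
  qed (simp_all add: con_simps)
qed

text \<open>
  Internal predicates and sets with no atom, free or bound, of level below \<open>M\<close>. Totality of
  substitution is by induction on the distance from \<open>M\<close> to the level of the substituted atom,
  and then on the structure of the term.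
\<close>
inductive pred_above :: "int \<Rightarrow> 'a::atom ipred \<Rightarrow> bool" and set_above :: "int \<Rightarrow> int \<Rightarrow> 'a iset \<Rightarrow> bool" for M where
  ip_Conj: "(\<forall>X. X |\<in>| Xs \<longrightarrow> pred_above M X) \<Longrightarrow> pred_above M (Conj Xs)"
| ip_Neg: "pred_above M X \<Longrightarrow> pred_above M (Neg X)"
| ip_All: "M \<le> level a \<Longrightarrow> pred_above M X \<Longrightarrow> pred_above M (Forall a X)"
| ip_Elt: "set_above M i x \<Longrightarrow> level a = i + 1 \<Longrightarrow> pred_above M (Elt x a)"
| ist_Atm: "M \<le> i \<Longrightarrow> level a = i \<Longrightarrow> set_above M i (Atm a)"
| ist_Compr: "M \<le> i - 1 \<Longrightarrow> level a = i - 1 \<Longrightarrow> pred_above M X \<Longrightarrow> set_above M i (Compr a X)"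

lemma ip_internal:
  fixes X :: "'a::atom ipred" and x :: "'a iset"
  shows "pred_above M X \<Longrightarrow> internal_pred X" and "set_above M i x \<Longrightarrow> internal_set i x"
  by (induct rule: pred_above_set_above.inducts) (auto intro!: internal_pred_internal_set.intros simp: atoms_def)

lemma ip_mono:
  fixes X :: "'a::atom ipred" and x :: "'a iset"
  shows "pred_above M X \<Longrightarrow> N \<le> M \<Longrightarrow> pred_above N X" and "set_above M i x \<Longrightarrow> N \<le> M \<Longrightarrow> set_above N i x"
  by (induct rule: pred_above_set_above.inducts) (auto intro!: pred_above_set_above.intros)

lemma internal_ip:
  fixes X :: "'a::atom ipred" and x :: "'a iset"
  shows "internal_pred X \<Longrightarrow> \<exists>M. pred_above M X" and "internal_set i x \<Longrightarrow> \<exists>M. set_above M i x"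
proof (induct rule: internal_pred_internal_set.inducts)
  case (1 Xs)
  then obtain m where m: "\<And>X. X |\<in>| Xs \<Longrightarrow> pred_above (m X) X" by metis
  have "Min (insert 0 (m ` fset Xs)) \<le> m X" if "X |\<in>| Xs" for X
    using that by simp
  then obtain N where "\<And>X. X |\<in>| Xs \<Longrightarrow> N \<le> m X" by blast
  with m have "pred_above N X" if "X |\<in>| Xs" for X using ip_mono(1) that by blast
  then show ?case using ip_Conj by blast
next
  case (2 X) then show ?case by (blast intro: ip_Neg)
next
  case (3 X a)
  then obtain M where M: "pred_above M X" by blast
  have "pred_above (min M (level a)) (Forall a X)" by (intro ip_All ip_mono(1)[OF M]) simp_all
  then show ?case by blast
next
  case (4 i x a)
  then obtain M where "set_above M i x" by blast
  then have "pred_above M (Elt x a)" using 4(3) by (intro ip_Elt) (simp_all add: atoms_def)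
  then show ?case by blast
next
  case (5 a i)
  then have "set_above i i (Atm a)" by (intro ist_Atm) (simp_all add: atoms_def)
  then show ?case by blast
next
  case (6 a i X)
  then obtain M where M: "pred_above M X" by blast
  have "set_above (min M (level a)) i (Compr a X)" using 6(1) by (intro ist_Compr ip_mono(1)[OF M]) (simp_all add: atoms_def)
  then show ?case by blast
qed

definition level_perm :: "('a::atom \<Rightarrow> 'a) \<Rightarrow> bool" where "level_perm \<pi> \<longleftrightarrow> bij \<pi> \<and> (\<forall>a. level (\<pi> a) = level a)"
lemma lp_good: "level_perm \<pi> \<Longrightarrow> renaming \<pi>" by (simp add: level_perm_def renaming_def)
lemma lp_level: "level_perm \<pi> \<Longrightarrow> level (\<pi> a) = level a" by (simp add: level_perm_def)
lemma lp_transpose: "level a = level b \<Longrightarrow> level_perm (transpose a b)"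
  unfolding level_perm_def by (metis bij_transpose transpose_apply_first transpose_apply_second transpose_apply_other)
lemma lp_comp: "level_perm \<pi> \<Longrightarrow> level_perm \<sigma> \<Longrightarrow> level_perm (\<pi> \<circ> \<sigma>)" by (simp add: level_perm_def bij_comp)
lemma lp_id: "level_perm id" by (simp add: level_perm_def)

lemma ip_ren:
  fixes X :: "'a::atom ipred" and x :: "'a iset"
  shows "pred_above M X \<Longrightarrow> level_perm \<pi> \<Longrightarrow> pred_above M (ren_p \<pi> X)" and "set_above M i x \<Longrightarrow> level_perm \<pi> \<Longrightarrow> set_above M i (ren_s \<pi> x)"
  by (induct rule: pred_above_set_above.inducts) (auto intro!: pred_above_set_above.intros simp: ren_simps lp_good lp_level)

lemma internal_ren:
  fixes X :: "'a::atom ipred" and x :: "'a iset"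
  shows "internal_pred X \<Longrightarrow> level_perm \<pi> \<Longrightarrow> internal_pred (ren_p \<pi> X)" and "internal_set i x \<Longrightarrow> level_perm \<pi> \<Longrightarrow> internal_set i (ren_s \<pi> x)"
  using internal_ip ip_ren ip_internal by metis+

lemma subst_rel_total:
  fixes Z :: "'a::atom ipred" and z x :: "'a iset"
  shows "(set_above M (level a) x \<longrightarrow> pred_above M Z \<longrightarrow> (\<exists>W. subst_p_rel Z a x W \<and> pred_above M W))
    \<and> (set_above M (level a) x \<longrightarrow> set_above M i z \<longrightarrow> (\<exists>w. subst_s_rel z a x w \<and> set_above M i w))"
proof (induct "nat (level a - M)" arbitrary: a x Z z i rule: less_induct)
  case less
  note outer = less.hyps
  have *: "(pred_above M Z \<longrightarrow> (\<forall>\<rho>. level_perm \<rho> \<longrightarrow> (\<exists>W. subst_p_rel (ren_p \<rho> Z) a x W \<and> pred_above M W)))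
     \<and> (set_above M i z \<longrightarrow> (\<forall>\<rho>. level_perm \<rho> \<longrightarrow> (\<exists>w. subst_s_rel (ren_s \<rho> z) a x w \<and> set_above M i w)))"
    if x: "set_above M (level a) x"
  proof (rule pred_above_set_above.induct, safe del: notI)
    fix Xs :: "'a ipred fset" and \<rho> :: "'a \<Rightarrow> 'a"
    assume IH: "\<forall>X. X |\<in>| Xs \<longrightarrow> pred_above M X \<and> (\<forall>\<rho>. level_perm \<rho> \<longrightarrow> (\<exists>W. subst_p_rel (ren_p \<rho> X) a x W \<and> pred_above M W))"
      and r: "level_perm \<rho>"
    have "\<forall>X. \<exists>W. X |\<in>| ren_p \<rho> |`| Xs \<longrightarrow> subst_p_rel X a x W \<and> pred_above M W"
      using IH r by auto
    then obtain f where f: "\<And>X. X |\<in>| ren_p \<rho> |`| Xs \<Longrightarrow> subst_p_rel X a x (f X) \<and> pred_above M (f X)" by metis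
    have "subst_p_rel (Conj (ren_p \<rho> |`| Xs)) a x (Conj (f |`| (ren_p \<rho> |`| Xs)))"
      using f by (intro sub_Conj) blast
    moreover have "pred_above M (Conj (f |`| (ren_p \<rho> |`| Xs)))"
      using f by (intro ip_Conj) auto
    ultimately show "\<exists>W. subst_p_rel (ren_p \<rho> (Conj Xs)) a x W \<and> pred_above M W"
      using r by (auto simp: ren_simps lp_good)
  next
    fix X :: "'a ipred" and \<rho> :: "'a \<Rightarrow> 'a"
    assume IH: "\<forall>\<rho>. level_perm \<rho> \<longrightarrow> (\<exists>W. subst_p_rel (ren_p \<rho> X) a x W \<and> pred_above M W)" and r: "level_perm \<rho>"
    then show "\<exists>W. subst_p_rel (ren_p \<rho> (Neg X)) a x W \<and> pred_above M W"
      by (auto simp: ren_simps lp_good intro!: sub_Neg ip_Neg)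
  next
    fix b :: 'a and X :: "'a ipred" and \<rho> :: "'a \<Rightarrow> 'a"
    assume IH: "\<forall>\<rho>. level_perm \<rho> \<longrightarrow> (\<exists>W. subst_p_rel (ren_p \<rho> X) a x W \<and> pred_above M W)" and r: "level_perm \<rho>" and b: "M \<le> level b"
    obtain c where c: "c \<notin> {a} \<union> free_s x \<union> free_p (ren_p \<rho> X)" "level c = level (\<rho> b)"
      using fresh_atom_exists[of "{a} \<union> free_s x \<union> free_p (ren_p \<rho> X)" "level (\<rho> b)"] finite_free by auto
    have 1: "ren_p \<rho> (Forall b X) = Forall c (ren_p (transpose c (\<rho> b) \<circ> \<rho>) X)"
      using r c All_rename[of c "\<rho> b" "ren_p \<rho> X"] by (simp add: ren_simps lp_good ren_comp good_transpose)
    obtain W where "subst_p_rel (ren_p (transpose c (\<rho> b) \<circ> \<rho>) X) a x W" "pred_above M W"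
      using IH lp_comp[OF lp_transpose r] c(2) by blast
    then have "subst_p_rel (ren_p \<rho> (Forall b X)) a x (Forall c W)" "pred_above M (Forall c W)"
      unfolding 1 using c r b by (auto intro!: sub_All ip_All simp: lp_level)
    then show "\<exists>W. subst_p_rel (ren_p \<rho> (Forall b X)) a x W \<and> pred_above M W" by blast
  next
    fix j and y :: "'a iset" and b :: 'a and \<rho> :: "'a \<Rightarrow> 'a"
    assume IH: "\<forall>\<rho>. level_perm \<rho> \<longrightarrow> (\<exists>w. subst_s_rel (ren_s \<rho> y) a x w \<and> set_above M j w)" and b: "level b = j + 1" and r: "level_perm \<rho>"
    obtain y' where y': "subst_s_rel (ren_s \<rho> y) a x y'" "set_above M j y'" using IH r by blast
    have rr: "ren_p \<rho> (Elt y b) = Elt (ren_s \<rho> y) (\<rho> b)" using r by (simp add: ren_simps lp_good)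
    show "\<exists>W. subst_p_rel (ren_p \<rho> (Elt y b)) a x W \<and> pred_above M W"
    proof (cases "\<rho> b = a")
      case False
      then have "subst_p_rel (ren_p \<rho> (Elt y b)) a x (Elt y' (\<rho> b))" using y' unfolding rr by (intro sub_Elt_other)
      moreover have "pred_above M (Elt y' (\<rho> b))" using y' b r by (intro ip_Elt) (auto simp: lp_level)
      ultimately show ?thesis by blast
    next
      case True
      then have la: "level a = j + 1" using b r lp_level by metis
      from x show ?thesis
      proof cases
        case (ist_Atm n)
        then have "subst_p_rel (ren_p \<rho> (Elt y b)) a x (Elt y' n)" using y' unfolding rr True by (auto intro: sub_Elt_Atm)
        moreover have "pred_above M (Elt y' n)" using y' ist_Atm la by (intro ip_Elt) auto
        ultimately show ?thesis by blast
      next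
        case (ist_Compr d X)
        obtain c where c: "c \<notin> {a} \<union> free_s (ren_s \<rho> y) \<union> free_p X" "level c = level d"
          using fresh_atom_exists[of "{a} \<union> free_s (ren_s \<rho> y) \<union> free_p X" "level d"] finite_free by auto
        let ?X = "ren_p (transpose c d) X"
        have x': "x = Compr c ?X" using ist_Compr c Compr_rename[of c d X] by auto
        have "pred_above M ?X" using ist_Compr c by (intro ip_ren lp_transpose)
        moreover have "set_above M (level c) y'" using y' c ist_Compr la by simp
        moreover have "nat (level c - M) < nat (level a - M)" using c ist_Compr by auto
        ultimately obtain W where W: "subst_p_rel ?X c y' W" "pred_above M W" using outer by blast
        have "subst_p_rel (Elt (ren_s \<rho> y) a) a (Compr c ?X) W"
          using c y' W unfolding x' by (intro sub_Elt_Compr) auto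
        then show ?thesis using W unfolding rr True x' by blast
      qed
    qed
  next
    fix j and b :: 'a and \<rho> :: "'a \<Rightarrow> 'a"
    assume M: "M \<le> level b" and r: "level_perm \<rho>"
    show "\<exists>w. subst_s_rel (ren_s \<rho> (Atm b)) a x w \<and> set_above M (level b) w"
    proof (cases "\<rho> b = a")
      case True
      then have "level b = level a" using lp_level[OF r] by metis
      then show ?thesis using True x r by (auto simp: ren_simps lp_good intro: sub_Atm)
    next
      case False
      then have "subst_s_rel (ren_s \<rho> (Atm b)) a x (Atm (\<rho> b))" using r by (auto simp: ren_simps lp_good intro: sub_Atm_other)
      moreover have "set_above M (level b) (Atm (\<rho> b))" using M r by (intro ist_Atm) (auto simp: lp_level)
      ultimately show ?thesis by blast
    qed
  next
    fix j and b :: 'a and X :: "'a ipred" and \<rho> :: "'a \<Rightarrow> 'a"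
    assume IH: "\<forall>\<rho>. level_perm \<rho> \<longrightarrow> (\<exists>W. subst_p_rel (ren_p \<rho> X) a x W \<and> pred_above M W)" and r: "level_perm \<rho>" and b: "M \<le> j - 1" "level b = j - 1"
    obtain c where c: "c \<notin> {a} \<union> free_s x \<union> free_p (ren_p \<rho> X)" "level c = level (\<rho> b)"
      using fresh_atom_exists[of "{a} \<union> free_s x \<union> free_p (ren_p \<rho> X)" "level (\<rho> b)"] finite_free by auto
    have 1: "ren_s \<rho> (Compr b X) = Compr c (ren_p (transpose c (\<rho> b) \<circ> \<rho>) X)"
      using r c Compr_rename[of c "\<rho> b" "ren_p \<rho> X"] by (simp add: ren_simps lp_good ren_comp good_transpose)
    obtain W where "subst_p_rel (ren_p (transpose c (\<rho> b) \<circ> \<rho>) X) a x W" "pred_above M W"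
      using IH lp_comp[OF lp_transpose r] c(2) by blast
    then have "subst_s_rel (ren_s \<rho> (Compr b X)) a x (Compr c W)" "set_above M j (Compr c W)"
      unfolding 1 using c r b by (auto intro!: sub_Compr ist_Compr simp: lp_level)
    then show "\<exists>w. subst_s_rel (ren_s \<rho> (Compr b X)) a x w \<and> set_above M j w" by blast
  qed
  show ?case using * lp_id ren_id by metis
qed

lemma subst_p_eq: "subst_p_rel Z a x W \<Longrightarrow> Z[a \<mapsto>\<^sub>p x] = W"
  unfolding subst_p_def using subst_rel_unique(1) by blast
lemma subst_s_eq: "subst_s_rel z a x w \<Longrightarrow> z[a \<mapsto>\<^sub>s x] = w"
  unfolding subst_s_def using subst_rel_unique(2) by blast

lemma subst_p_rel_subst:
  assumes "internal_pred Z" "x \<in> \<L> (level a)"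
  shows "subst_p_rel Z a x (Z[a \<mapsto>\<^sub>p x])" "internal_pred (Z[a \<mapsto>\<^sub>p x])"
proof -
  obtain M N where "pred_above M Z" "set_above N (level a) x" using assms internal_ip unfolding isets_def by blast
  then have "pred_above (min M N) Z" "set_above (min M N) (level a) x" using ip_mono by (metis min.cobounded1 min.cobounded2)+
  then obtain W where "subst_p_rel Z a x W" "pred_above (min M N) W" using subst_rel_total by blast
  then show "subst_p_rel Z a x (Z[a \<mapsto>\<^sub>p x])" "internal_pred (Z[a \<mapsto>\<^sub>p x])"
    using subst_p_eq ip_internal by metis+
qed

lemma subst_s_rel_subst:
  assumes "z \<in> \<L> i" "x \<in> \<L> (level a)"
  shows "subst_s_rel z a x (z[a \<mapsto>\<^sub>s x])" "z[a \<mapsto>\<^sub>s x] \<in> \<L> i"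
proof -
  obtain M N where "set_above M i z" "set_above N (level a) x" using assms internal_ip unfolding isets_def by blast
  then have "set_above (min M N) i z" "set_above (min M N) (level a) x" using ip_mono by (metis min.cobounded1 min.cobounded2)+
  then obtain W where "subst_s_rel z a x W" "set_above (min M N) i W" using subst_rel_total by blast
  then show "subst_s_rel z a x (z[a \<mapsto>\<^sub>s x])" "z[a \<mapsto>\<^sub>s x] \<in> \<L> i"
    using subst_s_eq ip_internal unfolding isets_def by (metis mem_Collect_eq)+
qed

lemma internal_inject:
  shows "internal_set i (Atm a) \<Longrightarrow> level a = i"
    and "internal_set i (Compr a X) \<Longrightarrow> level a = i - 1 \<and> internal_pred X"
proof -
  show "internal_set i (Atm a) \<Longrightarrow> level a = i"
    by (erule internal_set.cases) (auto simp: con_simps atoms_def)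
  assume "internal_set i (Compr a X)"
  then show "level a = i - 1 \<and> internal_pred X"
  proof cases
    case (2 b Y)
    then have "level a = level b" "Y = ren_p (transpose b a) X" using Compr_inject by metis+
    then show ?thesis using 2 ren_eq_same internal_ren(1)[OF _ lp_transpose] by (metis atoms_def mem_Collect_eq)
  qed (simp add: con_simps)
qed

lemma concrete_Compr: "level b = level a \<Longrightarrow> b \<notin> free_s (Compr a X) \<Longrightarrow> concrete (Compr a X) b = ren_p (transpose b a) X"
  unfolding concrete_def
proof (rule the_equality)
  assume b: "level b = level a" "b \<notin> free_s (Compr a X)"
  then show "\<exists>c Y. Compr a X = Compr c Y \<and> level b = level c \<and> ren_p (transpose b a) X = ren_p (transpose b c) Y" by blast
  fix W assume "\<exists>c Y. Compr a X = Compr c Y \<and> level b = level c \<and> W = ren_p (transpose b c) Y"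
  then obtain c Y where c: "Compr a X = Compr c Y" "level b = level c" "W = ren_p (transpose b c) Y" by blast
  have 1: "Compr a X = Compr b (ren_p (transpose b a) X)" using b by (intro Compr_rename) (simp_all add: free_simps)
  have 2: "Compr c Y = Compr b (ren_p (transpose b c) Y)" using b c by (intro Compr_rename) (auto simp: free_simps)
  have "Compr b (ren_p (transpose b a) X) = Compr b W" using 1 2 c by metis
  from Compr_inject[OF this] show "W = ren_p (transpose b a) X" by (simp add: transpose_same ren_id)
qed

lemma subst_rename:
  assumes "internal_pred X" "y \<in> \<L> (level a)" "level b = level a" "a \<notin> free_s y" "b \<notin> free_s y" "b \<notin> free_p X - {a}"
  shows "(ren_p (transpose b a) X)[b \<mapsto>\<^sub>p y] = X[a \<mapsto>\<^sub>p y]"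
proof (rule subst_p_eq)
  let ?W = "X[a \<mapsto>\<^sub>p y]"
  note s = subst_p_rel_subst(1)[OF assms(1,2)]
  have "ren_s (transpose b a) y = y" using assms by (intro ren_fresh)
  moreover have "ren_p (transpose b a) ?W = ?W"
  proof (cases "a = b")
    case False
    then show ?thesis using subst_rel_free(1)[OF s] assms by (intro ren_fresh) auto
  qed (simp add: transpose_same ren_id)
  ultimately show "subst_p_rel (ren_p (transpose b a) X) b y ?W"
    using subst_rel_equivariant(1)[OF s good_transpose[OF assms(3)]] by simp
qed

lemma mem_Atm: "mem i y (Atm a) = Elt y a"
  by (auto simp: mem_def is_Atm_def con_simps)

lemma mem_Compr:
  assumes "internal_set i (Compr a X)" "y \<in> \<L> (i - 1)" "a \<notin> free_s y"
  shows "mem i y (Compr a X) = X[a \<mapsto>\<^sub>p y]"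
proof -
  define b where "b = fresh_atom (i - 1) (free_s (Compr a X) \<union> free_s y)"
  have b: "b \<notin> free_s (Compr a X)" "b \<notin> free_s y" "level b = i - 1"
    using fresh_atom_spec[of "free_s (Compr a X) \<union> free_s y" "i - 1"] finite_free by (auto simp: b_def)
  note i = internal_inject(2)[OF assms(1)]
  have "mem i y (Compr a X) = (concrete (Compr a X) b)[b \<mapsto>\<^sub>p y]"
    unfolding mem_def b_def Let_def by (auto simp add: is_Atm_def con_simps)
  also have "\<dots> = (ren_p (transpose b a) X)[b \<mapsto>\<^sub>p y]"
    using b i by (simp add: concrete_Compr)
  also have "\<dots> = X[a \<mapsto>\<^sub>p y]"
    using assms b i by (intro subst_rename) (auto simp: free_simps)
  finally show ?thesis .
qed

lemma subst_p_simps: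
  assumes x: "x \<in> \<L> (level a)"
  shows "internal_pred (Conj Xs) \<Longrightarrow> (Conj Xs)[a \<mapsto>\<^sub>p x] = Conj ((\<lambda>X. X[a \<mapsto>\<^sub>p x]) |`| Xs)"
    and "internal_pred X \<Longrightarrow> (Neg X)[a \<mapsto>\<^sub>p x] = Neg (X[a \<mapsto>\<^sub>p x])"
    and "internal_pred X \<Longrightarrow> b \<noteq> a \<Longrightarrow> b \<notin> free_s x \<Longrightarrow> (Forall b X)[a \<mapsto>\<^sub>p x] = Forall b (X[a \<mapsto>\<^sub>p x])"
    and "y \<in> \<L> (level b - 1) \<Longrightarrow> b \<noteq> a \<Longrightarrow> (Elt y b)[a \<mapsto>\<^sub>p x] = Elt (y[a \<mapsto>\<^sub>s x]) b"
    and "y \<in> \<L> (level a - 1) \<Longrightarrow> (Elt y a)[a \<mapsto>\<^sub>p x] = mem (level a) (y[a \<mapsto>\<^sub>s x]) x"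
    and "(Atm a)[a \<mapsto>\<^sub>s x] = x"
    and "b \<noteq> a \<Longrightarrow> (Atm b)[a \<mapsto>\<^sub>s x] = Atm b"
    and "internal_pred X \<Longrightarrow> b \<noteq> a \<Longrightarrow> b \<notin> free_s x \<Longrightarrow> (Compr b X)[a \<mapsto>\<^sub>s x] = Compr b (X[a \<mapsto>\<^sub>p x])"
proof -
  note p = subst_p_rel_subst(1)[OF _ x]
  note s = subst_s_rel_subst(1)[OF _ x]
  show "internal_pred X \<Longrightarrow> (Neg X)[a \<mapsto>\<^sub>p x] = Neg (X[a \<mapsto>\<^sub>p x])"
    by (intro subst_p_eq sub_Neg p)
  show "internal_pred X \<Longrightarrow> b \<noteq> a \<Longrightarrow> b \<notin> free_s x \<Longrightarrow> (Forall b X)[a \<mapsto>\<^sub>p x] = Forall b (X[a \<mapsto>\<^sub>p x])"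
    by (intro subst_p_eq sub_All p)
  show "y \<in> \<L> (level b - 1) \<Longrightarrow> b \<noteq> a \<Longrightarrow> (Elt y b)[a \<mapsto>\<^sub>p x] = Elt (y[a \<mapsto>\<^sub>s x]) b"
    by (intro subst_p_eq sub_Elt_other s)
  show "(Atm a)[a \<mapsto>\<^sub>s x] = x" by (intro subst_s_eq sub_Atm)
  show "b \<noteq> a \<Longrightarrow> (Atm b)[a \<mapsto>\<^sub>s x] = Atm b" by (intro subst_s_eq sub_Atm_other)
  show "internal_pred X \<Longrightarrow> b \<noteq> a \<Longrightarrow> b \<notin> free_s x \<Longrightarrow> (Compr b X)[a \<mapsto>\<^sub>s x] = Compr b (X[a \<mapsto>\<^sub>p x])"
    by (intro subst_s_eq sub_Compr p)
  show "(Conj Xs)[a \<mapsto>\<^sub>p x] = Conj ((\<lambda>X. X[a \<mapsto>\<^sub>p x]) |`| Xs)" if "internal_pred (Conj Xs)"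
  proof (intro subst_p_eq sub_Conj allI impI p)
    fix X assume "X |\<in>| Xs"
    then show "internal_pred X" using that by (auto elim: internal_pred.cases simp: con_simps)
  qed
  show "(Elt y a)[a \<mapsto>\<^sub>p x] = mem (level a) (y[a \<mapsto>\<^sub>s x]) x" if y: "y \<in> \<L> (level a - 1)"
  proof -
    have "internal_set (level a) x" using x by (simp add: isets_def)
    then show ?thesis
    proof cases
      case (1 n)
      then show ?thesis using s[OF y] by (auto simp: mem_Atm intro!: subst_p_eq sub_Elt_Atm)
    next
      case (2 d X)
      let ?F = "{a} \<union> free_s y \<union> free_p X \<union> free_s (y[a \<mapsto>\<^sub>s x])"
      obtain c where c: "c \<notin> ?F" "level c = level d"
        using fresh_atom_exists[of ?F "level d"] finite_free by auto
      let ?X = "ren_p (transpose c d) X"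
      have x': "x = Compr c ?X" using 2 c Compr_rename[of c d X] by auto
      have X: "internal_pred ?X" using 2 c by (intro internal_ren lp_transpose)
      have lc: "level c = level a - 1" using 2 c by (simp add: atoms_def)
      note y' = subst_s_rel_subst[OF y x]
      have "(Elt y a)[a \<mapsto>\<^sub>p Compr c ?X] = ?X[c \<mapsto>\<^sub>p y[a \<mapsto>\<^sub>s x]]"
      proof (intro subst_p_eq sub_Elt_Compr)
        show "subst_s_rel y a (Compr c ?X) (y[a \<mapsto>\<^sub>s x])" using y'(1) unfolding x' .
        show "subst_p_rel ?X c (y[a \<mapsto>\<^sub>s x]) (?X[c \<mapsto>\<^sub>p y[a \<mapsto>\<^sub>s x]])"
          using X y'(2) lc by (intro subst_p_rel_subst) simp_all
      qed (use c in auto)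
      moreover have "mem (level a) (y[a \<mapsto>\<^sub>s x]) (Compr c ?X) = ?X[c \<mapsto>\<^sub>p y[a \<mapsto>\<^sub>s x]]"
        using x y'(2) c unfolding x' by (intro mem_Compr) (simp_all add: isets_def)
      ultimately show ?thesis using x' by metis
    qed
  qed
qed

lemma mem_ren:
  assumes "x \<in> \<L> i" "y \<in> \<L> (i - 1)" "level_perm \<pi>"
  shows "ren_p \<pi> (mem i y x) = mem i (ren_s \<pi> y) (ren_s \<pi> x)"
proof -
  have "internal_set i x" using assms by (simp add: isets_def)
  then show ?thesis
  proof cases
    case (1 a)
    then show ?thesis using assms by (simp add: mem_Atm ren_simps lp_good)
  next
    case (2 d X)
    obtain c where c: "c \<notin> free_s y \<union> free_p X" "level c = level d"
      using fresh_atom_exists[of "free_s y \<union> free_p X" "level d"] finite_free by auto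
    let ?X = "ren_p (transpose c d) X"
    have x': "x = Compr c ?X" using 2 c Compr_rename[of c d X] by auto
    have X: "internal_pred ?X" using 2 c by (intro internal_ren lp_transpose)
    have lc: "level c = i - 1" using 2 c by (simp add: atoms_def)
    have y: "y \<in> \<L> (level c)" using assms lc by simp
    have rx: "ren_s \<pi> x = Compr (\<pi> c) (ren_p \<pi> ?X)" using x' assms(3) by (simp add: ren_simps lp_good)
    have "mem i y x = ?X[c \<mapsto>\<^sub>p y]" using assms(1,2) c unfolding x' by (intro mem_Compr) (simp_all add: isets_def)
    moreover have "mem i (ren_s \<pi> y) (Compr (\<pi> c) (ren_p \<pi> ?X)) = (ren_p \<pi> ?X)[\<pi> c \<mapsto>\<^sub>p ren_s \<pi> y]"
    proof (rule mem_Compr)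
      show "internal_set i (Compr (\<pi> c) (ren_p \<pi> ?X))"
        using internal_ren(2)[of i x \<pi>] assms rx by (simp add: isets_def)
      show "ren_s \<pi> y \<in> \<L> (i - 1)" using internal_ren(2) assms by (simp add: isets_def)
      show "\<pi> c \<notin> free_s (ren_s \<pi> y)" using c assms by (simp add: free_ren lp_good good_inj inj_image_mem_iff)
    qed
    moreover have "(ren_p \<pi> ?X)[\<pi> c \<mapsto>\<^sub>p ren_s \<pi> y] = ren_p \<pi> (?X[c \<mapsto>\<^sub>p y])"
      by (intro subst_p_eq subst_rel_equivariant subst_p_rel_subst X y lp_good assms)
    ultimately show ?thesis using rx by metis
  qed
qed

lemma Eq_fresh:
  assumes x: "x \<in> \<L> i" and x': "x' \<in> \<L> i" and c: "level c = i - 1" "c \<notin> free_s x \<union> free_s x'"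
  shows "Eq i x x' = Forall c (Iff (mem i (Atm c) x) (mem i (Atm c) x'))"
proof -
  define d where "d = fresh_atom (i - 1) (free_s x \<union> free_s x')"
  have d: "d \<notin> free_s x" "d \<notin> free_s x'" "level d = i - 1"
    using fresh_atom_spec[of "free_s x \<union> free_s x'" "i - 1"] finite_free by (auto simp: d_def)
  let ?\<tau> = "transpose c d"
  have t: "level_perm ?\<tau>" using c d by (intro lp_transpose) simp
  have A: "Atm d \<in> \<L> (i - 1)" using d by (auto simp: isets_def atoms_def intro: internal_pred_internal_set.intros)
  have m: "ren_p ?\<tau> (mem i (Atm d) z) = mem i (Atm c) z" if "z \<in> \<L> i" "c \<notin> free_s z" "d \<notin> free_s z" for z
    using mem_ren[OF that(1) A t] that c d by (simp add: ren_simps lp_good[OF t] ren_fresh)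
  let ?B = "Iff (mem i (Atm d) x) (mem i (Atm d) x')"
  have B: "ren_p ?\<tau> ?B = Iff (mem i (Atm c) x) (mem i (Atm c) x')"
    using m x x' c d by (simp add: Iff_def Imp_def Disj_def ren_simps lp_good[OF t])
  have mf: "free_p (mem i (Atm d) z) \<subseteq> free_s z \<union> {d}" if "z \<in> \<L> i" for z
  proof -
    have "internal_set i z" using that by (simp add: isets_def)
    then show ?thesis
    proof cases
      case (1 a) then show ?thesis by (simp add: mem_Atm free_simps)
    next
      case (2 e X)
      obtain b where b: "b \<notin> {d} \<union> free_p X" "level b = level e"
        using fresh_atom_exists[of "{d} \<union> free_p X" "level e"] finite_free by auto
      have z': "z = Compr b (ren_p (transpose b e) X)" using 2 b Compr_rename[of b e X] by auto
      have "internal_pred (ren_p (transpose b e) X)" using 2 b by (intro internal_ren lp_transpose)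
      moreover have "level b = i - 1" using 2 b by (simp add: atoms_def)
      moreover have "mem i (Atm d) z = (ren_p (transpose b e) X)[b \<mapsto>\<^sub>p Atm d]"
        using b that unfolding z' by (intro mem_Compr A) (auto simp: isets_def free_simps)
      ultimately show ?thesis
        using subst_rel_free(1)[OF subst_p_rel_subst(1), of _ "Atm d" b] A by (fastforce simp: z' free_simps)
    qed
  qed
  have "c \<notin> free_p ?B - {d}"
    using mf[OF x] mf[OF x'] c by (auto simp: Iff_def Imp_def Disj_def free_simps)
  then have "Forall d ?B = Forall c (ren_p ?\<tau> ?B)" using c d by (intro All_rename) simp_all
  then show ?thesis unfolding B by (simp add: Eq_def d_def Let_def)
qed

end

theory Submission
  imports Defs
begin

text \<open>
  A point satisfies universal instantiation, because the small set of exceptions to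
  \<open>\<forall>[a]X\<close> cannot contain the generous set of atoms that stand for a given internal set.
  Applied to \<open>x \<doteq> x'\<close> this makes \<open>x\<close> and \<open>x'\<close> extensionally equal, hence intensionally
  equal, and the theorem follows by induction on \<open>Z\<close>. The case of \<open>\<in>(y,a)\<close> needs no
  induction on levels: \<open>u = y[a\<mapsto>x]\<close> and \<open>u' = y[a\<mapsto>x']\<close> belong to the same atoms by
  intensional equality, hence to the same internal sets by universal instantiation, and
  so \<open>u\<close> belongs to \<open>x\<close> iff it belongs to \<open>x'\<close> iff \<open>u'\<close> does.
\<close>

section \<open>Small and generous sets of atoms\<close>

text \<open>The layers of the two unions are equipollent by induction on \<open>n\<close>, so
  \<open>S\<close> is a countable union of sets that inject into the infinite set
  \<open>T\<close>.\<close>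

lemma card_beth_omega_lepoll:
  includes cardinal_syntax
  assumes "card_beth_omega S" "card_beth_omega T"
  shows "S \<lesssim> T"
proof -
  obtain B where B: "B 0 \<approx> (UNIV :: nat set)" "\<And>n. B (Suc n) \<approx> Pow (B n)" "S = (\<Union>n. B n)"
    using assms(1) unfolding card_beth_omega_def by blast
  obtain C where C: "C 0 \<approx> (UNIV :: nat set)" "\<And>n. C (Suc n) \<approx> Pow (C n)" "T = (\<Union>n. C n)"
    using assms(2) unfolding card_beth_omega_def by blast
  have BC: "B n \<approx> C n" for n
  proof (induct n)
    case 0
    show ?case by (rule eqpoll_trans[OF B(1) eqpoll_sym[OF C(1)]])
  next
    case (Suc n)
    then obtain f where "bij_betw f (B n) (C n)" unfolding eqpoll_def by blast
    then have "bij_betw ((`) f) (Pow (B n)) (Pow (C n))" by (rule bij_betw_Pow)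
    then have "Pow (B n) \<approx> Pow (C n)" unfolding eqpoll_def by blast
    from eqpoll_trans[OF eqpoll_trans[OF B(2) this] eqpoll_sym[OF C(2)]] show ?case .
  qed
  have "B n \<lesssim> T" for n
    by (rule lepoll_trans[OF eqpoll_imp_lepoll[OF BC] subset_imp_lepoll]) (auto simp: C(3))
  then have "|B n| \<le>o |T|" for n
    by (simp add: lepoll_def card_of_ordLeq)
  moreover have "infinite T" using assms(2) by (rule beth_infinite)
  moreover from this have "|UNIV :: nat set| \<le>o |T|" by (simp add: infinite_iff_card_of_nat)
  ultimately have "|S| \<le>o |T|"
    unfolding B(3) by (intro card_of_UNION_ordLeq_infinite) simp_all
  then show ?thesis by (simp add: lepoll_def card_of_ordLeq)
qed

text \<open>Smallness is witnessed by an arbitrary \<open>T\<close> of the right cardinality, so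
  \<open>T\<close> has to be injected back into \<open>S\<close> for a contradiction.\<close>

lemma generous_not_small: "generous S \<Longrightarrow> \<not> small S"
  unfolding generous_def small_def
  using card_beth_omega_lepoll lesspoll_trans2 by blast

lemma New_cofinite:
  fixes i :: int and F :: "'a::atom set"
  assumes "finite F" "\<And>a. a \<in> atoms i \<Longrightarrow> a \<notin> F \<Longrightarrow> \<Phi> a"
  shows "New i \<Phi>"
proof -
  have "card_beth_omega (atoms i :: 'a set)" unfolding atoms_def by (rule card_level)
  moreover from this have "F \<prec> (atoms i :: 'a set)"
    using assms(1) beth_infinite finite_lesspoll_infinite by blast
  ultimately have "small F" unfolding small_def by blast
  then show ?thesis
    unfolding New_def using assms(2) by (elim small_subset) auto
qed

lemma New_witness:
  assumes "New i \<Phi>" "generous {a \<in> atoms i. \<Psi> a}"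
  obtains a where "\<Phi> a" "\<Psi> a"
proof -
  have "\<not> {a \<in> atoms i. \<Psi> a} \<subseteq> atoms i - {a' \<in> atoms i. \<Phi> a'}"
    using assms generous_not_small small_subset unfolding New_def by blast
  then show ?thesis using that by blast
qed

section \<open>Universal instantiation in a point\<close>

text \<open>Generous naming yields a generous set of atoms that agree with \<open>y\<close> on
  \<open>X\<close>; one of them is no exception to the quantifier.\<close>

lemma point_Forall_instance:
  assumes "point p" "y \<in> \<L> (level c)" "internal_pred X" "p \<Turnstile> Forall c X"
  shows "p \<Turnstile> X[c \<mapsto>\<^sub>p y]"
proof -
  have "New (level c) (\<lambda>a. p \<Turnstile> ren_p (transpose a c) X)"
    using assms(4) by (simp add: valid_simps)
  moreover have "generous {a \<in> atoms (level c). p \<Turnstile> ren_p (transpose a c) X \<longleftrightarrow> p \<Turnstile> X[c \<mapsto>\<^sub>p y]}"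
    using assms(1,2,3) unfolding point_def generously_names_def by (simp add: atoms_def)
  ultimately obtain a where "p \<Turnstile> ren_p (transpose a c) X"
      "p \<Turnstile> ren_p (transpose a c) X \<longleftrightarrow> p \<Turnstile> X[c \<mapsto>\<^sub>p y]"
    by (rule New_witness)
  then show ?thesis by blast
qed

section \<open>Substitution and membership predicates\<close>

lemma valid_Iff: "p \<Turnstile> Iff X Y \<longleftrightarrow> (p \<Turnstile> X \<longleftrightarrow> p \<Turnstile> Y)"
  by (auto simp: Iff_def Imp_def Disj_def valid_simps)

lemma ren_Iff: "renaming \<pi> \<Longrightarrow> ren_p \<pi> (Iff X Y) = Iff (ren_p \<pi> X) (ren_p \<pi> Y)"
  by (simp add: Iff_def Imp_def Disj_def ren_simps)

lemma internal_Iff: "internal_pred X \<Longrightarrow> internal_pred Y \<Longrightarrow> internal_pred (Iff X Y)"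
  unfolding Iff_def Imp_def Disj_def by (auto intro!: internal_pred_internal_set.intros)

lemma subst_Iff:
  assumes "internal_pred X" "internal_pred Y" "x \<in> \<L> (level a)"
  shows "(Iff X Y)[a \<mapsto>\<^sub>p x] = Iff (X[a \<mapsto>\<^sub>p x]) (Y[a \<mapsto>\<^sub>p x])"
  using assms unfolding Iff_def Imp_def Disj_def
  by (simp add: subst_p_simps internal_pred_internal_set.intros)

lemma subst_rel_fresh:
  shows "subst_p_rel Z a x W \<Longrightarrow> a \<notin> free_p Z \<Longrightarrow> W = Z"
    and "subst_s_rel z a x w \<Longrightarrow> a \<notin> free_s z \<Longrightarrow> w = z"
proof (induct rule: subst_p_rel_subst_s_rel.inducts)
  case (sub_Conj Xs a x f)
  then have "f |`| Xs = id |`| Xs" by (intro fset.map_cong) (auto simp: free_simps)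
  then show ?case by simp
qed (auto simp: free_simps)

text \<open>The rules keep binders away from \<open>a\<close> and \<open>n\<close>, and the clause
  for a comprehension cannot apply to \<open>Atm n\<close>. As \<open>n\<close> is not free in
  \<open>Z\<close>, the swap does nothing but put \<open>n\<close> for \<open>a\<close>.\<close>

lemma subst_rel_Atm:
  shows "subst_p_rel Z a x W \<Longrightarrow> x = Atm n \<Longrightarrow> level n = level a \<Longrightarrow> n \<notin> free_p Z
      \<Longrightarrow> W = ren_p (transpose n a) Z"
    and "subst_s_rel z a x w \<Longrightarrow> x = Atm n \<Longrightarrow> level n = level a \<Longrightarrow> n \<notin> free_s z
      \<Longrightarrow> w = ren_s (transpose n a) z"
proof (induct rule: subst_p_rel_subst_s_rel.inducts)
  case (sub_Conj Xs a x f)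
  then have "f |`| Xs = ren_p (transpose n a) |`| Xs"
    by (intro fset.map_cong) (auto simp: free_simps)
  then show ?case using sub_Conj by (simp add: ren_simps good_transpose)
qed (auto simp: free_simps ren_simps good_transpose con_simps)

lemma Atm_isets: "Atm c \<in> \<L> (level c)"
  by (auto simp: isets_def atoms_def intro: internal_pred_internal_set.intros)

text \<open>Inversion with the bound atom already renamed away from \<open>F\<close>, so that
  \<open>mem_Compr\<close> and \<open>subst_rename\<close> apply directly.\<close>

lemma iset_cases:
  assumes "x \<in> \<L> i" "finite F"
  obtains (Atm) a where "x = Atm a" "level a = i"
  | (Compr) d X where "x = Compr d X" "level d = i - 1" "internal_pred X" "d \<notin> F"
proof -
  have "internal_set i x" using assms(1) by (simp add: isets_def)
  then show thesis
  proof cases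
    case (1 a)
    then show thesis using Atm by (simp add: atoms_def)
  next
    case (2 e Y)
    obtain d where d: "d \<notin> F \<union> free_p Y" "level d = level e"
      using fresh_atom_exists[of "F \<union> free_p Y" "level e"] assms(2) finite_free by auto
    then have "x = Compr d (ren_p (transpose d e) Y)" using 2 Compr_rename[of d e Y] by auto
    moreover have "internal_pred (ren_p (transpose d e) Y)"
      using 2 d by (intro internal_ren lp_transpose)
    ultimately show thesis using 2 d by (intro Compr[of d]) (auto simp: atoms_def)
  qed
qed

lemma mem_internal:
  assumes "x \<in> \<L> i" "y \<in> \<L> (i - 1)"
  shows "internal_pred (mem i y x)"
  using assms(1) finite_free(2)[of y]
proof (cases rule: iset_cases)
  case (Atm a)
  then show ?thesis using assms(2)
    by (auto simp: mem_Atm isets_def atoms_def intro!: internal_pred_internal_set.intros)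
next
  case (Compr d X)
  then show ?thesis using assms by (simp add: mem_Compr isets_def[of i] subst_p_rel_subst(2))
qed

text \<open>This identifies the instances of the quantifier in \<open>Eq\<close>. For a
  comprehension, membership of the fresh atom \<open>c\<close> is the body with its bound atom
  renamed to \<open>c\<close>, and \<open>subst_rename\<close> undoes that renaming.\<close>

lemma subst_mem_Atm:
  assumes x: "x \<in> \<L> i" and y: "y \<in> \<L> (i - 1)" and c: "level c = i - 1" "c \<notin> free_s x" "c \<notin> free_s y"
  shows "(mem i (Atm c) x)[c \<mapsto>\<^sub>p y] = mem i y x"
proof -
  have A: "Atm c \<in> \<L> (i - 1)" using Atm_isets[of c] c by simp
  have "finite (insert c (free_s y))" by (simp add: finite_free)
  with x show ?thesis
  proof (cases rule: iset_cases)
    case (Atm a)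
    then show ?thesis using assms A by (auto simp: mem_Atm subst_p_simps free_simps)
  next
    case (Compr d X)
    then have X: "c \<notin> free_p X" using c by (auto simp: free_simps)
    have "mem i (Atm c) x = X[d \<mapsto>\<^sub>p Atm c]"
      using Compr x A by (auto simp: isets_def[of i] free_simps intro!: mem_Compr)
    also have "\<dots> = ren_p (transpose c d) X"
      using Compr X A c by (intro subst_rel_Atm(1)[OF subst_p_rel_subst(1)]) auto
    finally have "(mem i (Atm c) x)[c \<mapsto>\<^sub>p y] = X[d \<mapsto>\<^sub>p y]"
      using Compr X c y by (simp add: subst_rename)
    also have "\<dots> = mem i y x"
      using Compr x y by (simp add: mem_Compr isets_def[of i])
    finally show ?thesis .
  qed
qed

section \<open>Extensional and intensional equality in a point\<close>

lemma point_Eq_ext_eq: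
  assumes p: "point p" and x: "x \<in> \<L> i" and x': "x' \<in> \<L> i" and eq: "p \<Turnstile> Eq i x x'"
  shows "ext_eq p i x x'"
proof -
  have "p \<Turnstile> mem i y x \<longleftrightarrow> p \<Turnstile> mem i y x'" if y: "y \<in> \<L> (i - 1)" for y
  proof -
    \<comment> \<open>By \<open>Eq_fresh\<close> the bound atom of \<open>Eq\<close> may be chosen
      after \<open>y\<close> and fresh for it, as \<open>subst_mem_Atm\<close> requires.\<close>
    obtain c where c: "c \<notin> free_s x \<union> free_s x' \<union> free_s y" "level c = i - 1"
      using fresh_atom_exists[of "free_s x \<union> free_s x' \<union> free_s y" "i - 1"] finite_free by auto
    let ?X = "mem i (Atm c) x" and ?X' = "mem i (Atm c) x'"
    have int: "internal_pred ?X" "internal_pred ?X'"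
      using x x' c Atm_isets[of c] by (simp_all add: mem_internal)
    have "p \<Turnstile> (Iff ?X ?X')[c \<mapsto>\<^sub>p y]"
      using p y c eq Eq_fresh[OF x x', of c] int
      by (intro point_Forall_instance) (simp_all add: internal_Iff)
    then show ?thesis
      using x x' y c int by (simp add: subst_Iff subst_mem_Atm valid_Iff)
  qed
  then show ?thesis unfolding ext_eq_def extension_def by blast
qed

text \<open>The premise makes \<open>Iff (Elt u c) (Elt u' c)\<close> valid for all atoms outside a
  finite set, hence valid under a universal quantifier over \<open>c\<close>, which can then be
  instantiated by \<open>x\<close>.\<close>

lemma point_mem_cong:
  assumes p: "point p" and u: "u \<in> \<L> (i - 1)" "u' \<in> \<L> (i - 1)" and x: "x \<in> \<L> i"
    and eq: "\<And>b. b \<in> atoms i \<Longrightarrow> (b, u) \<in> p \<longleftrightarrow> (b, u') \<in> p"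
  shows "p \<Turnstile> mem i u x \<longleftrightarrow> p \<Turnstile> mem i u' x"
proof -
  let ?F = "free_s u \<union> free_s u'"
  obtain c where c: "c \<notin> ?F" "level c = i"
    using fresh_atom_exists[of ?F i] finite_free by auto
  let ?X = "Iff (Elt u c) (Elt u' c)"
  have int: "internal_pred (Elt v c)" if "v \<in> \<L> (i - 1)" for v
    using that c by (auto simp: isets_def atoms_def intro: internal_pred_internal_set.intros(4)[of "i - 1"])
  have "New i (\<lambda>b. p \<Turnstile> ren_p (transpose b c) ?X)"
  proof (rule New_cofinite[of ?F])
    fix b assume "b \<in> atoms i" "b \<notin> ?F"
    then show "p \<Turnstile> ren_p (transpose b c) ?X"
      using c eq by (simp add: ren_Iff ren_simps ren_fresh good_transpose valid_Iff valid_simps atoms_def)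
  qed (simp add: finite_free)
  then have "p \<Turnstile> ?X[c \<mapsto>\<^sub>p x]"
    using p x u c int by (intro point_Forall_instance) (auto simp: valid_simps intro!: internal_Iff)
  \<comment> \<open>Only the containing atom \<open>c\<close> is replaced, so the instance compares
    \<open>mem i u x\<close> with \<open>mem i u' x\<close>.\<close>
  moreover have "v[c \<mapsto>\<^sub>s x] = v" if "v \<in> \<L> (i - 1)" "c \<notin> free_s v" for v
    using that x c by (intro subst_rel_fresh(2)[OF subst_s_rel_subst(1)]) auto
  ultimately show ?thesis
    using u x c int by (simp add: subst_Iff subst_p_simps valid_Iff)
qed

text \<open>
  The renaming \<open>\<pi>\<close> is there for the induction: a bound atom is first made fresh and then
  replaced by the instances that the quantifier ranges over.
\<close>

lemma point_subst_cong:
  fixes Z :: "'a::atom ipred" and z :: "'a iset"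
  assumes p: "point p" and x: "x \<in> \<L> (level a)" and x': "x' \<in> \<L> (level a)"
    and ext: "ext_eq p (level a) x x'"
  shows "internal_pred Z \<Longrightarrow> level_perm \<pi> \<Longrightarrow>
      p \<Turnstile> (ren_p \<pi> Z)[a \<mapsto>\<^sub>p x] \<longleftrightarrow> p \<Turnstile> (ren_p \<pi> Z)[a \<mapsto>\<^sub>p x']"
    and "internal_set j z \<Longrightarrow> True"
proof (induct Z and j z arbitrary: \<pi> rule: internal_pred_internal_set.inducts)
  case (1 Xs)
  then have "internal_pred (Conj (ren_p \<pi> |`| Xs))"
    by (auto intro!: internal_pred_internal_set.intros internal_ren)
  then show ?case using 1 x x' by (auto simp: ren_simps lp_good subst_p_simps valid_simps)
next
  case (2 X)
  then show ?case using x x'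
    by (simp add: ren_simps lp_good subst_p_simps valid_simps internal_ren)
next
  case (3 X b)
  let ?F = "{a} \<union> free_s x \<union> free_s x'" and ?b = "\<pi> b"
  obtain c where c: "c \<notin> ?F \<union> free_p (ren_p \<pi> X)" "level c = level ?b"
    using fresh_atom_exists[of "?F \<union> free_p (ren_p \<pi> X)" "level ?b"] finite_free by auto
  let ?\<sigma> = "transpose c ?b \<circ> \<pi>"
  let ?X = "ren_p ?\<sigma> X"
  have \<sigma>: "level_perm ?\<sigma>" using c 3 by (intro lp_comp lp_transpose)
  have eq: "ren_p \<pi> (Forall b X) = Forall c ?X"
    using 3 c All_rename[of c ?b "ren_p \<pi> X"] by (simp add: ren_simps lp_good ren_comp good_transpose)
  have X: "internal_pred ?X" using 3 \<sigma> by (simp add: internal_ren)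
  \<comment> \<open>Both \<open>c\<close> and \<open>d\<close> are fresh for \<open>a\<close> and
    \<open>u\<close>, so the swap passes through the substitution. An instance of the substituted
    body is thus a substituted instance, to which the induction hypothesis for the composed renaming
    applies.\<close>
  have swap: "ren_p (transpose d c) (?X[a \<mapsto>\<^sub>p u]) = (ren_p (transpose d c \<circ> ?\<sigma>) X)[a \<mapsto>\<^sub>p u]"
    if d: "level d = level c" "d \<notin> ?F" and u: "u \<in> {x, x'}" for d u
  proof -
    have g: "renaming (transpose d c)" using d by (simp add: good_transpose)
    have "subst_p_rel ?X a u (?X[a \<mapsto>\<^sub>p u])" using X x x' u by (auto intro: subst_p_rel_subst)
    from subst_rel_equivariant(1)[OF this g]
    have "subst_p_rel (ren_p (transpose d c \<circ> ?\<sigma>) X) a u (ren_p (transpose d c) (?X[a \<mapsto>\<^sub>p u]))"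
      using d c u g \<sigma> by (auto simp: ren_fresh ren_comp lp_good)
    then show ?thesis by (simp add: subst_p_eq)
  qed
  have "New (level c) (\<lambda>d. p \<Turnstile> ren_p (transpose d c) (?X[a \<mapsto>\<^sub>p x]))
    \<longleftrightarrow> New (level c) (\<lambda>d. p \<Turnstile> ren_p (transpose d c) (?X[a \<mapsto>\<^sub>p x']))"
  \<comment> \<open>The atoms \<open>d\<close> for which \<open>swap\<close> fails are finitely
    many, which \<open>New\<close> ignores.\<close>
  proof (rule New_cong_finite[of ?F])
    fix d assume d: "d \<in> atoms (level c)" "d \<notin> ?F"
    then have "level_perm (transpose d c \<circ> ?\<sigma>)"
      using \<sigma> by (simp add: lp_comp lp_transpose atoms_def)
    from 3(2)[OF this] show "p \<Turnstile> ren_p (transpose d c) (?X[a \<mapsto>\<^sub>p x])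
        \<longleftrightarrow> p \<Turnstile> ren_p (transpose d c) (?X[a \<mapsto>\<^sub>p x'])"
      using d by (simp add: swap atoms_def del: o_apply)
  qed (simp add: finite_free)
  then show ?case using X x x' c unfolding eq by (simp add: subst_p_simps valid_simps)
next
  case (4 j y b)
  let ?y = "ren_s \<pi> y" and ?b = "\<pi> b"
  let ?u = "?y[a \<mapsto>\<^sub>s x]" and ?u' = "?y[a \<mapsto>\<^sub>s x']"
  have y: "?y \<in> \<L> j" using 4 by (simp add: isets_def internal_ren)
  have b: "level ?b = j + 1" using 4 by (simp add: lp_level atoms_def)
  \<comment> \<open>Intensional equality handles the change from \<open>x\<close> to
    \<open>x'\<close> inside \<open>?y\<close> at once, which is why the induction claims only
    \<open>True\<close> of internal sets.\<close>
  have "int_eq p (level a) x x'" using p x x' ext unfolding point_def extensional_def by blast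
  then have int: "(d, ?u) \<in> p \<longleftrightarrow> (d, ?u') \<in> p" if "d \<in> atoms (j + 1)" for d
    using y that unfolding int_eq_def by (simp add: atoms_def)
  show ?case
  proof (cases "?b = a")
    case False
    then show ?thesis using 4 x x' y b int[of ?b]
      by (simp add: ren_simps lp_good subst_p_simps valid_simps atoms_def)
  next
    case True
    then have j: "j = level a - 1" using b by simp
    have u: "?u \<in> \<L> (level a - 1)" "?u' \<in> \<L> (level a - 1)"
      using y x x' j by (simp_all add: subst_s_rel_subst(2))
    have "p \<Turnstile> mem (level a) ?u x \<longleftrightarrow> p \<Turnstile> mem (level a) ?u x'"
      using ext u unfolding ext_eq_def extension_def by blast
    also have "\<dots> \<longleftrightarrow> p \<Turnstile> mem (level a) ?u' x'"
      using int j by (intro point_mem_cong[OF p u x']) simp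
    finally show ?thesis using 4 x x' y j True
      by (simp add: ren_simps lp_good subst_p_simps)
  qed
qed auto

theorem theorem8p20:
  fixes i :: int and x x' :: "'a::atom iset" and a :: 'a and Z :: "'a ipred"
  assumes "x \<in> \<L> i" and "x' \<in> \<L> i" and "a \<in> atoms i" and "internal_pred Z"
  shows "(\<forall>p. point p \<longrightarrow> p \<Turnstile> Eq i x x' \<longrightarrow> p \<Turnstile> Iff (Z[a \<mapsto>\<^sub>p x]) (Z[a \<mapsto>\<^sub>p x']))
    \<and> extent (Eq i x x') \<subseteq> extent (Iff (Z[a \<mapsto>\<^sub>p x]) (Z[a \<mapsto>\<^sub>p x']))"
proof -
  have "p \<Turnstile> Iff (Z[a \<mapsto>\<^sub>p x]) (Z[a \<mapsto>\<^sub>p x'])" if "point p" "p \<Turnstile> Eq i x x'" for p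
  proof -
    have "level a = i" using assms(3) by (simp add: atoms_def)
    then show ?thesis
      using point_subst_cong(1)[OF that(1), of x a x' Z id] point_Eq_ext_eq[OF that(1) assms(1,2) that(2)] assms
      by (simp add: valid_Iff lp_id ren_id)
  qed
  then show ?thesis unfolding extent_def by blast
qed

end
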